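(* Let $G$ be a very well-covered graph with vertex set $\{x_1,\ldots,x_n\}$, let $R=K[x_1,\ldots,x_n]$ be a polynomial ring over a field $K$, and let $I(G)\subset R$ be its edge ideal. Then the symbolic powers of $I(G)$ have non-decreasing regularity, that is, $$\operatorname{reg}(R/I(G)^{(k)})\leq\operatorname{reg}(R/I(G)^{(k+1)})\quad\text{for all } k\geq 1.$$
   Context: The edge ideal $I(G)$ is generated by all $x_ix_j$ with $\{x_i,x_j\}$ an edge of the (finite simple) graph $G$. $G$ is unmixed if all its minimal vertex covers have the same cardinality. $G$ is very well-covered if $G$ is unmixed, has no isolated vertices, and $|V(G)|=2\operatorname{ht}(I(G))$, where $\operatorname{ht}$ denotes height. For a squarefree monomial ideal $I$ with associated primes $\mathfrak{p}_1,\ldots,\mathfrak{p}_s$, the $k$-th symbolic power is $I^{(k)}=\mathfrak{p}_1^k\cap\cdots\cap\mathfrak{p}_s^k$. $\operatorname{reg}$ is Castelnuovo--Mumford regularity. *)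

theory Defs
  imports
    "HOL-Algebra.Algebraic_Closure_Type"
    "HOL-Algebra.Ideal_Product"
    "HOL-Library.Poly_Mapping"
    "HOL-Library.Extended_Nat"
    "HOL-Library.Extended_Real"
    "Jordan_Normal_Form.Matrix"
begin

section \<open>Ideals in a commutative ring\<close>

definition prime_height :: "('a, 'b) ring_scheme \<Rightarrow> 'a set \<Rightarrow> enat" where
  "prime_height R P =
     Sup {enat t | t c. c t = P \<and> (\<forall>i\<le>t. primeideal (c i) R) \<and> (\<forall>i<t. c i \<subset> c (Suc i))}"

definition ideal_height :: "('a, 'b) ring_scheme \<Rightarrow> 'a set \<Rightarrow> enat" where
  "ideal_height R I = Inf (prime_height R ` {P. primeideal P R \<and> I \<subseteq> P})"

definition associated_primes :: "('a, 'b) ring_scheme \<Rightarrow> 'a set \<Rightarrow> 'a set set" where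
  "associated_primes R I =
     {P. primeideal P R \<and> (\<exists>f\<in>carrier R. P = {r \<in> carrier R. r \<otimes>\<^bsub>R\<^esub> f \<in> I})}"

text \<open>The formula for squarefree monomial ideals, intersecting the ordinary powers of the associated
  primes; for other ideals it is not the symbolic power in general. Powers of ideals are taken in
  the multiplicative monoid of all ideals.\<close>

definition symbolic_power :: "('a, 'b) ring_scheme \<Rightarrow> 'a set \<Rightarrow> nat \<Rightarrow> 'a set" where
  "symbolic_power R I k = (\<Inter>P\<in>associated_primes R I. P [^]\<^bsub>ideals_set R\<^esub> k)"


section \<open>The standard graded polynomial ring\<close>

text \<open>\<open>('v, 'k) mpoly\<close> with \<open>'v\<close> finite is the polynomial ring over \<open>'k\<close> with one variable for each
  element of \<open>'v\<close>; a polynomial maps exponent vectors to coefficients.\<close>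

type_synonym ('v, 'k) mpoly = "('v \<Rightarrow>\<^sub>0 nat) \<Rightarrow>\<^sub>0 'k"

definition var :: "'v \<Rightarrow> ('v, 'k::field) mpoly" where
  "var v = Poly_Mapping.single (Poly_Mapping.single v 1) 1"

definition monom_deg :: "('v \<Rightarrow>\<^sub>0 nat) \<Rightarrow> nat" where
  "monom_deg m = (\<Sum>v\<in>Poly_Mapping.keys m. Poly_Mapping.lookup m v)"

text \<open>Zero is homogeneous of every degree and is the only homogeneous polynomial of negative
  degree.\<close>

definition homogeneous :: "int \<Rightarrow> ('v, 'k::field) mpoly \<Rightarrow> bool" where
  "homogeneous d f \<longleftrightarrow> (\<forall>m\<in>Poly_Mapping.keys f. int (monom_deg m) = d)"


section \<open>Minimal graded free resolutions and Castelnuovo-Mumford regularity\<close>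

text \<open>
  A complex \<open>\<dots> \<rightarrow> F\<^sub>2 \<rightarrow> F\<^sub>1 \<rightarrow> F\<^sub>0 \<rightarrow> R/I \<rightarrow> 0\<close> of finitely generated graded free modules, where
  \<open>F\<^sub>i\<close> is the direct sum of \<open>R(-shift i q)\<close> over \<open>q < rank i\<close>.
  The matrix \<open>diff i\<close> represents \<open>F\<^sub>i\<^sub>+\<^sub>1 \<rightarrow> F\<^sub>i\<close>; the entries of \<open>aug\<close> are representatives in \<open>R\<close>
  of the images of the basis elements of \<open>F\<^sub>0\<close> in \<open>R/I\<close>.\<close>

record 'r free_complex =
  rank :: "nat \<Rightarrow> nat"
  shift :: "nat \<Rightarrow> nat \<Rightarrow> int"
  aug :: "'r vec"
  diff :: "nat \<Rightarrow> 'r mat"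

definition graded_free_resolution ::
  "('v::finite, 'k::field) mpoly set \<Rightarrow> ('v, 'k) mpoly free_complex \<Rightarrow> bool" where
  "graded_free_resolution I F \<longleftrightarrow>
     aug F \<in> carrier_vec (rank F 0) \<and>
     (\<forall>i. diff F i \<in> carrier_mat (rank F i) (rank F (Suc i))) \<and>
     (\<forall>q<rank F 0. homogeneous (shift F 0 q) (aug F $ q)) \<and>
     (\<forall>i. \<forall>p<rank F i. \<forall>q<rank F (Suc i).
        homogeneous (shift F (Suc i) q - shift F i p) (diff F i $$ (p, q))) \<and>
     (\<forall>f. \<exists>v\<in>carrier_vec (rank F 0). f - aug F \<bullet> v \<in> I) \<and>
     (\<forall>v\<in>carrier_vec (rank F 0).
        aug F \<bullet> v \<in> I \<longleftrightarrow> v \<in> (\<lambda>w. diff F 0 *\<^sub>v w) ` carrier_vec (rank F 1)) \<and>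
     (\<forall>i. \<forall>v\<in>carrier_vec (rank F (Suc i)).
        diff F i *\<^sub>v v = 0\<^sub>v (rank F i) \<longleftrightarrow>
        v \<in> (\<lambda>w. diff F (Suc i) *\<^sub>v w) ` carrier_vec (rank F (Suc (Suc i))))"

text \<open>Minimality: all entries of the differentials lie in the ideal generated by the variables,
  that is, have constant coefficient zero.\<close>

definition minimal_graded_free_resolution ::
  "('v::finite, 'k::field) mpoly set \<Rightarrow> ('v, 'k) mpoly free_complex \<Rightarrow> bool" where
  "minimal_graded_free_resolution I F \<longleftrightarrow>
     graded_free_resolution I F \<and>
     (\<forall>i. \<forall>p<rank F i. \<forall>q<rank F (Suc i). Poly_Mapping.lookup (diff F i $$ (p, q)) 0 = 0)"

text \<open>The Betti number \<open>\<beta>\<^sub>i\<^sub>,\<^sub>j(R/I)\<close>, for \<open>I\<close> homogeneous: the number of copies of \<open>R(-j)\<close> in the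
  \<open>i\<close>-th module of a minimal graded free resolution of \<open>R/I\<close>. Such a resolution exists and is
  unique up to isomorphism, so the choice is immaterial.\<close>

definition graded_betti ::
  "('v::finite, 'k::field) mpoly set \<Rightarrow> nat \<Rightarrow> int \<Rightarrow> nat" where
  "graded_betti I i j =
     (SOME b. \<exists>F. minimal_graded_free_resolution I F \<and> b = card {q. q < rank F i \<and> shift F i q = j})"

text \<open>The regularity of the module \<open>R/I\<close> (not of \<open>I\<close>). For proper homogeneous \<open>I\<close> the supremum
  is a maximum over a finite nonempty set; the zero module has regularity \<open>-\<infinity>\<close>.\<close>

definition regularity_quotient :: "('v::finite, 'k::field) mpoly set \<Rightarrow> ereal" where
  "regularity_quotient I =
     Sup {ereal (real_of_int (j - int i)) | i j. graded_betti I i j \<noteq> 0}"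


section \<open>Graphs on the vertex set \<open>UNIV :: 'v set\<close>\<close>

definition simple_graph :: "'v::finite set set \<Rightarrow> bool" where
  "simple_graph E \<longleftrightarrow> (\<forall>e\<in>E. card e = 2)"

definition vertex_cover :: "'v::finite set set \<Rightarrow> 'v set \<Rightarrow> bool" where
  "vertex_cover E C \<longleftrightarrow> (\<forall>e\<in>E. e \<inter> C \<noteq> {})"

definition minimal_vertex_cover :: "'v::finite set set \<Rightarrow> 'v set \<Rightarrow> bool" where
  "minimal_vertex_cover E C \<longleftrightarrow> vertex_cover E C \<and> (\<forall>D. D \<subset> C \<longrightarrow> \<not> vertex_cover E D)"

definition unmixed :: "'v::finite set set \<Rightarrow> bool" where
  "unmixed E \<longleftrightarrow>
     (\<forall>C D. minimal_vertex_cover E C \<and> minimal_vertex_cover E D \<longrightarrow> card C = card D)"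

definition edge_ideal :: "'v::finite set set \<Rightarrow> ('v, 'k::field) mpoly set" where
  "edge_ideal E = genideal ring_of_type_algebra {var u * var v | u v. {u, v} \<in> E}"

text \<open>The field enters only through the polynomial ring in which the height is taken.\<close>

definition very_well_covered :: "'k::field itself \<Rightarrow> 'v::finite set set \<Rightarrow> bool" where
  "very_well_covered K E \<longleftrightarrow>
     unmixed E \<and> (\<forall>v. \<exists>e\<in>E. v \<in> e) \<and>
     enat (card (UNIV :: 'v set)) = 2 * ideal_height ring_of_type_algebra (edge_ideal E :: ('v, 'k) mpoly set)"

end

theory Submission
  imports Defs
begin

text \<open>
  Suppose that the edge \<open>{x, y}\<close> is met in exactly one vertex by every minimal vertex cover. The
  associated primes of \<open>I = I(G)\<close> are generated by minimal vertex covers, so the monomial \<open>xy\<close> has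
  order exactly one along each of them. Hence \<open>P\<^sup>k\<^sup>+\<^sup>1 : xy = P\<^sup>k\<close> for every associated prime \<open>P\<close>, and
  intersecting gives \<open>I\<^sup>(\<^sup>k\<^sup>+\<^sup>1\<^sup>) : xy = I\<^sup>(\<^sup>k\<^sup>)\<close>. The theorem follows from two facts.

  Such an edge exists (\<open>edge_met_once\<close>, \<open>very_well_covered_edge\<close>). In an unmixed graph without
  isolated vertices every independent set has at least as many neighbours as elements, so by Hall's
  theorem the complement of a minimal cover \<open>C\<close> can be matched into \<open>C\<close>. A chain of primes generated
  by variables shows that the height of \<open>I\<close> is at least the size of \<open>C\<close>; as the number of vertices is
  twice the height, \<open>C\<close> and its complement have the same size and the matching is perfect. A minimal
  cover has as many vertices as the matching has edges and meets each of these edges, so it meets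
  each of them once.

  Passing from a monomial ideal \<open>J\<close> to \<open>J : x\<^sup>t\<close> does not increase the regularity of the quotient
  (\<open>regularity_colon_monomial\<close>). A multigraded resolution of \<open>R/J\<close> is a sequence of matrices of
  scalars together with a multidegree \<open>a\<close> for each basis element; its part in multidegree \<open>b\<close> is a
  complex of vector spaces whose bases are the basis elements with \<open>a \<le> b\<close>. Keep the scalars and
  replace every \<open>a\<close> by the truncated difference \<open>a - t\<close>. Since \<open>a - t \<le> b\<close> iff \<open>a \<le> b + t\<close>, the part of
  the new complex in multidegree \<open>b\<close> is the part of the old one in multidegree \<open>b + t\<close>; therefore it
  is exact and resolves \<open>R/(J : x\<^sup>t)\<close> (\<open>scalar_resolution_colon\<close>). Degrees have only dropped. If the
  old resolution was minimal, its degrees are those of the Betti numbers of \<open>R/J\<close>; the new one need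
  not be minimal, but every degree of a minimal resolution of \<open>R/(J : x\<^sup>t)\<close> occurs in it
  (\<open>minimal_shift_occurs\<close>).
\<close>

section \<open>Exponent vectors and homogeneous parts\<close>

abbreviation lookup :: "('a \<Rightarrow>\<^sub>0 'b::zero) \<Rightarrow> 'a \<Rightarrow> 'b" where "lookup \<equiv> Poly_Mapping.lookup"
abbreviation keys :: "('a \<Rightarrow>\<^sub>0 'b::zero) \<Rightarrow> 'a set" where "keys \<equiv> Poly_Mapping.keys"

definition mdvd :: "('v \<Rightarrow>\<^sub>0 nat) \<Rightarrow> ('v \<Rightarrow>\<^sub>0 nat) \<Rightarrow> bool" (infix \<open>\<preceq>\<close> 50) where
  "a \<preceq> b \<longleftrightarrow> (\<forall>v. lookup a v \<le> lookup b v)"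

lemma mdvd_refl [simp]: "a \<preceq> a"
  by (simp add: mdvd_def)

lemma zero_mdvd [simp]: "0 \<preceq> a"
  by (simp add: mdvd_def)

lemma mdvd_trans [trans]: "a \<preceq> b \<Longrightarrow> b \<preceq> c \<Longrightarrow> a \<preceq> c"
  unfolding mdvd_def using le_trans by blast

lemma mdvd_antisym: "a \<preceq> b \<Longrightarrow> b \<preceq> a \<Longrightarrow> a = b"
  by (auto simp: mdvd_def intro!: poly_mapping_eqI le_antisym)

lemma mdvd_add [simp]: "a \<preceq> a + b" "b \<preceq> a + b"
  by (auto simp: mdvd_def lookup_add)

lemma mdvd_add_diff: "a \<preceq> b \<Longrightarrow> a + (b - a) = b"
  by (rule poly_mapping_eqI) (auto simp: mdvd_def lookup_add lookup_minus)

lemma diff_mdvd_iff: "a - t \<preceq> b \<longleftrightarrow> a \<preceq> b + t"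
  by (simp add: mdvd_def lookup_add lookup_minus le_diff_conv)

lemma monom_deg_UNIV: "monom_deg m = (\<Sum>v\<in>UNIV. lookup m v)" for m :: "'v::finite \<Rightarrow>\<^sub>0 nat"
  unfolding monom_deg_def by (rule sum.mono_neutral_left) (auto simp: in_keys_iff)

lemma monom_deg_add: "monom_deg (a + b) = monom_deg a + monom_deg b" for a b :: "'v::finite \<Rightarrow>\<^sub>0 nat"
  by (simp add: monom_deg_UNIV lookup_add sum.distrib)

lemma monom_deg_zero [simp]: "monom_deg 0 = 0"
  by (simp add: monom_deg_def)

lemma monom_deg_diff_le: "monom_deg (a - t) \<le> monom_deg a" for a t :: "'v::finite \<Rightarrow>\<^sub>0 nat"
  by (simp add: monom_deg_UNIV lookup_minus sum_mono)

lemma lookup_times: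
  fixes f g :: "('v \<Rightarrow>\<^sub>0 nat) \<Rightarrow>\<^sub>0 'k::comm_ring_1"
  shows "lookup (f * g) m = (\<Sum>l\<in>keys f. lookup f l * (if l \<preceq> m then lookup g (m - l) else 0))"
proof -
  have "(\<Sum>q. lookup g q when m = l + q) = (if l \<preceq> m then lookup g (m - l) else 0)" for l
  proof (cases "l \<preceq> m")
    case True
    then have "m = l + q \<longleftrightarrow> q = m - l" for q
      by (metis mdvd_add_diff add_diff_cancel_left')
    then show ?thesis using True by simp
  next
    case False
    then have "m \<noteq> l + q" for q by auto
    then show ?thesis using False by simp
  qed
  then have "lookup (f * g) m = (\<Sum>l. lookup f l * (if l \<preceq> m then lookup g (m - l) else 0))"
    by (simp add: lookup_mult)
  also have "\<dots> = (\<Sum>l\<in>keys f. lookup f l * (if l \<preceq> m then lookup g (m - l) else 0))"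
    by (rule Sum_any.expand_superset) (auto simp: in_keys_iff)
  finally show ?thesis .
qed

lemma lookup_single_times:
  fixes f :: "('v \<Rightarrow>\<^sub>0 nat) \<Rightarrow>\<^sub>0 'k::comm_ring_1"
  shows "lookup (Poly_Mapping.single a c * f) m = (if a \<preceq> m then c * lookup f (m - a) else 0)"
  by (cases "c = 0") (auto simp: lookup_times)

lemma lookup_times_zero:
  fixes f g :: "('v \<Rightarrow>\<^sub>0 nat) \<Rightarrow>\<^sub>0 'k::comm_ring_1"
  shows "lookup (f * g) 0 = lookup f 0 * lookup g 0"
proof -
  have "l \<preceq> 0 \<longleftrightarrow> l = 0" for l :: "'v \<Rightarrow>\<^sub>0 nat"
    using mdvd_antisym by fastforce
  then have "lookup (f * g) 0 = (\<Sum>l\<in>keys f. if l = 0 then lookup f 0 * lookup g 0 else 0)"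
    unfolding lookup_times by (intro sum.cong) auto
  then show ?thesis by (auto simp: in_keys_iff)
qed

lemma sum_single_keys: "(\<Sum>m\<in>keys f. Poly_Mapping.single m (lookup f m)) = f"
  by (rule poly_mapping_eqI)
    (auto simp: lookup_sum lookup_single when_def in_keys_iff)

definition graded_part :: "int \<Rightarrow> ('v, 'k::field) mpoly \<Rightarrow> ('v, 'k) mpoly" where
  "graded_part d f = Abs_poly_mapping (\<lambda>m. lookup f m when int (monom_deg m) = d)"

lemma lookup_graded_part: "lookup (graded_part d f) m = (lookup f m when int (monom_deg m) = d)"
proof -
  have "finite {m. (lookup f m when int (monom_deg m) = d) \<noteq> 0}"
    by (rule finite_subset[of _ "keys f"]) (auto simp: in_keys_iff)
  then show ?thesis by (simp add: graded_part_def)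
qed

lemma keys_graded_part: "keys (graded_part d f) \<subseteq> keys f"
  by (auto simp: in_keys_iff lookup_graded_part)

lemma graded_part_homogeneous: "homogeneous d (graded_part d f)"
  by (auto simp: homogeneous_def in_keys_iff lookup_graded_part)

lemma graded_part_id: "homogeneous d f \<Longrightarrow> graded_part d f = f"
  by (rule poly_mapping_eqI) (auto simp: homogeneous_def in_keys_iff lookup_graded_part when_def)

lemma graded_part_diff: "graded_part d (f - g) = graded_part d f - graded_part d g"
  by (rule poly_mapping_eqI) (simp add: lookup_graded_part lookup_minus when_def)

lemma graded_part_sum: "graded_part d (sum f A) = (\<Sum>x\<in>A. graded_part d (f x))"
  by (rule poly_mapping_eqI) (simp add: lookup_graded_part lookup_sum when_def)

lemma graded_part_times:
  fixes f g :: "('v::finite, 'k::field) mpoly"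
  assumes "homogeneous d g"
  shows "graded_part e (g * f) = g * graded_part (e - d) f"
proof (rule poly_mapping_eqI)
  fix m
  have "(lookup g l * (if l \<preceq> m then lookup f (m - l) else 0) when int (monom_deg m) = e)
      = lookup g l * (if l \<preceq> m then lookup (graded_part (e - d) f) (m - l) else 0)" if "l \<in> keys g" for l
  proof (cases "l \<preceq> m")
    case True
    then have "monom_deg m = monom_deg l + monom_deg (m - l)"
      by (metis mdvd_add_diff monom_deg_add)
    moreover have "int (monom_deg l) = d"
      using assms that by (auto simp: homogeneous_def)
    ultimately have "int (monom_deg m) = e \<longleftrightarrow> int (monom_deg (m - l)) = e - d" by auto
    with True show ?thesis by (simp add: lookup_graded_part mult_when)
  qed auto
  then have "(\<Sum>l\<in>keys g. lookup g l * (if l \<preceq> m then lookup f (m - l) else 0) when int (monom_deg m) = e)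
      = lookup (g * graded_part (e - d) f) m"
    unfolding lookup_times by (intro sum.cong) auto
  moreover have "(\<Sum>l\<in>keys g. h l when P) = (sum h (keys g) when P)" for h :: "_ \<Rightarrow> 'k" and P
    by (simp add: when_def)
  ultimately show "lookup (graded_part e (g * f)) m = lookup (g * graded_part (e - d) f) m"
    by (simp add: lookup_graded_part lookup_times)
qed

section \<open>Comparison of graded free resolutions\<close>

definition ring_ideal :: "'r::comm_ring_1 set \<Rightarrow> bool" where
  "ring_ideal I \<longleftrightarrow> 0 \<in> I \<and> (\<forall>a\<in>I. \<forall>b\<in>I. a + b \<in> I) \<and> (\<forall>a\<in>I. \<forall>r. r * a \<in> I)"

lemma ring_ideal_zero: "ring_ideal I \<Longrightarrow> 0 \<in> I"
  and ring_ideal_add: "ring_ideal I \<Longrightarrow> a \<in> I \<Longrightarrow> b \<in> I \<Longrightarrow> a + b \<in> I"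
  and ring_ideal_mult: "ring_ideal I \<Longrightarrow> a \<in> I \<Longrightarrow> r * a \<in> I"
  by (auto simp: ring_ideal_def)

lemma ring_ideal_diff: "ring_ideal I \<Longrightarrow> a \<in> I \<Longrightarrow> b \<in> I \<Longrightarrow> a - b \<in> I"
  using ring_ideal_add[of I a "- b"] ring_ideal_mult[of I b "- 1"] by simp

lemma ring_ideal_sum: "ring_ideal I \<Longrightarrow> (\<And>x. x \<in> A \<Longrightarrow> f x \<in> I) \<Longrightarrow> sum f A \<in> I"
  by (induction A rule: infinite_finite_induct) (auto intro: ring_ideal_zero ring_ideal_add)

text \<open>
  The convention for a graded map of degree zero from the free module with shifts \<open>t\<close> (columns)
  to the one with shifts \<open>s\<close> (rows).
\<close>

definition homogeneous_mat ::
  "(nat \<Rightarrow> int) \<Rightarrow> (nat \<Rightarrow> int) \<Rightarrow> ('v, 'k::field) mpoly mat \<Rightarrow> bool" where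
  "homogeneous_mat s t A \<longleftrightarrow>
     (\<forall>p<dim_row A. \<forall>q<dim_col A. homogeneous (t q - s p) (A $$ (p, q)))"

lemma factor_columns:
  fixes D :: "'r::comm_ring_1 mat"
  assumes D: "D \<in> carrier_mat n r" and A: "A \<in> carrier_mat n k"
    and im: "\<And>q. q < k \<Longrightarrow> col A q \<in> (\<lambda>w. D *\<^sub>v w) ` carrier_vec r"
  shows "\<exists>B\<in>carrier_mat r k. A = D * B"
proof -
  have "\<forall>q\<in>{..<k}. \<exists>w. w \<in> carrier_vec r \<and> col A q = D *\<^sub>v w"
    using im by blast
  from bchoice[OF this] obtain w
    where w: "\<And>q. q < k \<Longrightarrow> w q \<in> carrier_vec r" "\<And>q. q < k \<Longrightarrow> col A q = D *\<^sub>v w q"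
    by auto
  define B where "B = mat r k (\<lambda>(p, q). w q $ p)"
  have B: "B \<in> carrier_mat r k" by (simp add: B_def)
  have colB: "col B q = w q" if "q < k" for q
    using w(1)[OF that] that by (intro eq_vecI) (auto simp: B_def)
  have "A $$ (p, q) = (D * B) $$ (p, q)" if "p < n" "q < k" for p q
  proof -
    have "A $$ (p, q) = col A q $ p" using that A by simp
    also have "\<dots> = row D p \<bullet> col B q" using w(2)[OF that(2)] that colB D by simp
    finally show ?thesis using that D B by simp
  qed
  then have "A = D * B" using A D B by (intro eq_matI) auto
  with B show ?thesis by blast
qed

text \<open>
  As \<open>D\<close> and \<open>D * B\<close> are homogeneous, the product is unchanged when every entry of \<open>B\<close> is replaced
  by its homogeneous part of the expected degree.
\<close>

lemma homogeneous_factor: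
  fixes D :: "('v::finite, 'k::field) mpoly mat"
  assumes D: "D \<in> carrier_mat n r" and B: "B \<in> carrier_mat r k"
    and hD: "homogeneous_mat s t D" and hA: "homogeneous_mat s u (D * B)"
  shows "\<exists>B'\<in>carrier_mat r k. homogeneous_mat t u B' \<and> D * B = D * B'"
proof -
  define B' where "B' = mat r k (\<lambda>(p, q). graded_part (u q - t p) (B $$ (p, q)))"
  have B': "B' \<in> carrier_mat r k" by (simp add: B'_def)
  have "(D * B) $$ (p, q) = (D * B') $$ (p, q)" if p: "p < n" and q: "q < k" for p q
  proof -
    have "(D * B) $$ (p, q) = graded_part (u q - s p) ((D * B) $$ (p, q))"
      using hA D B p q by (subst graded_part_id) (auto simp: homogeneous_mat_def)
    also have "\<dots> = graded_part (u q - s p) (\<Sum>l = 0..<r. D $$ (p, l) * B $$ (l, q))"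
      using D B p q by (simp add: scalar_prod_def)
    also have "\<dots> = (\<Sum>l = 0..<r. graded_part (u q - s p) (D $$ (p, l) * B $$ (l, q)))"
      by (rule graded_part_sum)
    also have "\<dots> = (\<Sum>l = 0..<r. D $$ (p, l) * graded_part (u q - t l) (B $$ (l, q)))"
    proof (intro sum.cong refl)
      fix l assume "l \<in> {0..<r}"
      then have "homogeneous (t l - s p) (D $$ (p, l))"
        using hD D p by (auto simp: homogeneous_mat_def)
      from graded_part_times[OF this, of "u q - s p"]
      show "graded_part (u q - s p) (D $$ (p, l) * B $$ (l, q)) = D $$ (p, l) * graded_part (u q - t l) (B $$ (l, q))"
        by simp
    qed
    also have "\<dots> = (D * B') $$ (p, q)"
      using D B' p q by (auto simp: scalar_prod_def B'_def intro!: sum.cong)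
    finally show ?thesis .
  qed
  then have "D * B = D * B'" using D B B' by (intro eq_matI) auto
  moreover have "homogeneous_mat t u B'"
    by (auto simp: homogeneous_mat_def B'_def graded_part_homogeneous)
  ultimately show ?thesis using B' by blast
qed

lemma homogeneous_mat_mult:
  fixes A :: "('v::finite, 'k::field) mpoly mat"
  assumes A: "A \<in> carrier_mat n r" and B: "B \<in> carrier_mat r k"
    and hA: "homogeneous_mat s t A" and hB: "homogeneous_mat t u B"
  shows "homogeneous_mat s u (A * B)"
proof -
  have "homogeneous (u q - s p) ((A * B) $$ (p, q))" if p: "p < n" and q: "q < k" for p q
  proof -
    have "graded_part (u q - s p) (A $$ (p, l) * B $$ (l, q)) = A $$ (p, l) * B $$ (l, q)"
      if l: "l < r" for l
    proof -
      have "homogeneous (t l - s p) (A $$ (p, l))" "homogeneous (u q - t l) (B $$ (l, q))"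
        using hA hB A B p q l by (auto simp: homogeneous_mat_def)
      then show ?thesis
        using graded_part_times[of "t l - s p" "A $$ (p, l)" "u q - s p" "B $$ (l, q)"]
        by (simp add: graded_part_id)
    qed
    then have "(A * B) $$ (p, q) = graded_part (u q - s p) ((A * B) $$ (p, q))"
      using A B p q by (simp add: scalar_prod_def graded_part_sum)
    then show ?thesis by (metis graded_part_homogeneous)
  qed
  then show ?thesis using A B by (simp add: homogeneous_mat_def)
qed

lemma resolution_carrier:
  assumes "graded_free_resolution I F"
  shows "aug F \<in> carrier_vec (rank F 0)" "diff F i \<in> carrier_mat (rank F i) (rank F (Suc i))"
  using assms by (simp_all only: graded_free_resolution_def)

lemma resolution_augmentation:
  assumes F: "graded_free_resolution I F"
  shows "q < rank F 0 \<Longrightarrow> homogeneous (shift F 0 q) (aug F $ q)"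
    and "\<exists>v\<in>carrier_vec (rank F 0). f - aug F \<bullet> v \<in> I"
    and "v \<in> carrier_vec (rank F 0) \<Longrightarrow>
      aug F \<bullet> v \<in> I \<longleftrightarrow> v \<in> (\<lambda>w. diff F 0 *\<^sub>v w) ` carrier_vec (rank F 1)"
  using F by (simp_all only: graded_free_resolution_def)

lemma resolution_kernel:
  assumes "graded_free_resolution I F" and "v \<in> carrier_vec (rank F (Suc i))"
  shows "diff F i *\<^sub>v v = 0\<^sub>v (rank F i) \<longleftrightarrow>
      v \<in> (\<lambda>w. diff F (Suc i) *\<^sub>v w) ` carrier_vec (rank F (Suc (Suc i)))"
  using assms by (simp only: graded_free_resolution_def)

lemma resolution_homogeneous:
  assumes "graded_free_resolution I F"
  shows "homogeneous_mat (shift F i) (shift F (Suc i)) (diff F i)"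
proof -
  have "homogeneous (shift F (Suc i) q - shift F i p) (diff F i $$ (p, q))"
    if "p < rank F i" "q < rank F (Suc i)" for p q
    using assms that by (simp only: graded_free_resolution_def)
  then show ?thesis using resolution_carrier(2)[OF assms, of i] by (simp add: homogeneous_mat_def)
qed

lemma resolution_exact:
  assumes F: "graded_free_resolution I F"
    and A: "A \<in> carrier_mat (rank F (Suc i)) k" and z: "diff F i * A = 0\<^sub>m (rank F i) k"
  shows "\<exists>B\<in>carrier_mat (rank F (Suc (Suc i))) k. A = diff F (Suc i) * B"
proof (rule factor_columns[OF resolution_carrier(2)[OF F] A])
  fix q assume q: "q < k"
  have c: "col A q \<in> carrier_vec (rank F (Suc i))" using A q by auto
  have "diff F i *\<^sub>v col A q = col (diff F i * A) q"
    using resolution_carrier(2)[OF F] A q by (metis col_mult2)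
  also have "\<dots> = 0\<^sub>v (rank F i)" using q by (simp add: z)
  finally show "col A q \<in> (\<lambda>w. diff F (Suc i) *\<^sub>v w) ` carrier_vec (rank F (Suc (Suc i)))"
    using resolution_kernel[OF F c] by blast
qed

lemma resolution_exact_homogeneous:
  assumes F: "graded_free_resolution I F"
    and A: "A \<in> carrier_mat (rank F (Suc i)) k" and z: "diff F i * A = 0\<^sub>m (rank F i) k"
    and h: "homogeneous_mat (shift F (Suc i)) u A"
  shows "\<exists>B\<in>carrier_mat (rank F (Suc (Suc i))) k.
           homogeneous_mat (shift F (Suc (Suc i))) u B \<and> A = diff F (Suc i) * B"
proof -
  obtain B where B: "B \<in> carrier_mat (rank F (Suc (Suc i))) k" "A = diff F (Suc i) * B"
    using resolution_exact[OF F A z] by blast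
  with h show ?thesis
    using homogeneous_factor[OF resolution_carrier(2)[OF F] B(1) resolution_homogeneous[OF F]]
    by auto
qed

lemma resolution_complex:
  assumes F: "graded_free_resolution I F"
  shows "diff F i * diff F (Suc i) = 0\<^sub>m (rank F i) (rank F (Suc (Suc i)))"
proof (rule eq_matI)
  note c = resolution_carrier(2)[OF F]
  fix p q assume pq: "p < dim_row (0\<^sub>m (rank F i) (rank F (Suc (Suc i))) :: _ mat)"
    "q < dim_col (0\<^sub>m (rank F i) (rank F (Suc (Suc i))) :: _ mat)"
  let ?e = "unit_vec (rank F (Suc (Suc i))) q"
  have e: "?e \<in> carrier_vec (rank F (Suc (Suc i)))" by simp
  have "diff F (Suc i) *\<^sub>v ?e \<in> carrier_vec (rank F (Suc i))"
    using c e by (metis mult_mat_vec_carrier)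
  then have "diff F i *\<^sub>v (diff F (Suc i) *\<^sub>v ?e) = 0\<^sub>v (rank F i)"
    using resolution_kernel[OF F] e by blast
  moreover have "diff F (Suc i) *\<^sub>v ?e = col (diff F (Suc i)) q"
    using pq c[of "Suc i"] by (auto intro!: eq_vecI)
  moreover have "diff F i *\<^sub>v col (diff F (Suc i)) q = col (diff F i * diff F (Suc i)) q"
    using pq by (metis c col_mult2 index_zero_mat(3))
  ultimately have z: "col (diff F i * diff F (Suc i)) q = 0\<^sub>v (rank F i)" by metis
  have d: "diff F i * diff F (Suc i) \<in> carrier_mat (rank F i) (rank F (Suc (Suc i)))"
    using c by (metis mult_carrier_mat)
  have "(diff F i * diff F (Suc i)) $$ (p, q) = col (diff F i * diff F (Suc i)) q $ p"
    using pq d by (metis index_col index_zero_mat(2,3) carrier_matD)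
  with z show "(diff F i * diff F (Suc i)) $$ (p, q)
      = (0\<^sub>m (rank F i) (rank F (Suc (Suc i))) :: _ mat) $$ (p, q)"
    using pq by simp
qed (use resolution_carrier(2)[OF F, of i] resolution_carrier(2)[OF F, of "Suc i"] in auto)

lemma mat_add_diff_cancel:
  fixes A B :: "'r::comm_ring_1 mat"
  shows "A \<in> carrier_mat n k \<Longrightarrow> B \<in> carrier_mat n k \<Longrightarrow> A + B - B = A"
  by (intro eq_matI) auto

lemma col_minus_one:
  fixes A :: "'r::comm_ring_1 mat"
  shows "A \<in> carrier_mat n n \<Longrightarrow> q < n \<Longrightarrow> col (A - 1\<^sub>m n) q = col A q - unit_vec n q"
  by (intro eq_vecI) auto

definition graded_set :: "('v, 'k::field) mpoly set \<Rightarrow> bool" where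
  "graded_set I \<longleftrightarrow> (\<forall>f\<in>I. \<forall>d. graded_part d f \<in> I)"

text \<open>
  A map that respects the augmentations modulo \<open>I\<close> on basis vectors respects them on all vectors.
\<close>

lemma augmentation_apply:
  fixes a b :: "'r::comm_ring_1 vec"
  assumes I: "ring_ideal I" and a: "a \<in> carrier_vec n" and b: "b \<in> carrier_vec m"
    and A: "A \<in> carrier_mat m n" and u: "u \<in> carrier_vec n"
    and cong: "\<And>q. q < n \<Longrightarrow> a $ q - b \<bullet> col A q \<in> I"
  shows "a \<bullet> u - b \<bullet> (A *\<^sub>v u) \<in> I"
proof -
  have "b \<bullet> (A *\<^sub>v u) = (transpose_mat A *\<^sub>v b) \<bullet> u"
    using transpose_vec_mult_scalar[OF A u b] by simp
  also have "\<dots> = (\<Sum>q = 0..<n. (b \<bullet> col A q) * u $ q)"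
    using A u b by (auto simp: scalar_prod_def intro!: sum.cong) (simp add: mult.commute)
  finally have "a \<bullet> u - b \<bullet> (A *\<^sub>v u) = (\<Sum>q = 0..<n. u $ q * (a $ q - b \<bullet> col A q))"
    using u by (simp add: scalar_prod_def[of a u] algebra_simps sum_subtractf)
  also have "\<dots> \<in> I"
    using I cong by (intro ring_ideal_sum ring_ideal_mult) auto
  finally show ?thesis .
qed

text \<open>
  Arbitrary lifts of the generators, cut down to their homogeneous parts, still agree with them
  modulo \<open>I\<close> because \<open>I\<close> is graded.
\<close>

lemma lift_augmentation:
  fixes F M :: "('v::finite, 'k::field) mpoly free_complex"
  assumes gI: "graded_set I"
    and F: "graded_free_resolution I F" and M: "graded_free_resolution I M"
  shows "\<exists>A\<in>carrier_mat (rank F 0) (rank M 0). homogeneous_mat (shift F 0) (shift M 0) A \<and>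
           (\<forall>q<rank M 0. aug M $ q - aug F \<bullet> col A q \<in> I)"
proof -
  have ex: "\<exists>v\<in>carrier_vec (rank F 0). aug M $ q - aug F \<bullet> v \<in> I" for q
    using resolution_augmentation(2)[OF F] .
  then have "\<forall>q. \<exists>v. v \<in> carrier_vec (rank F 0) \<and> aug M $ q - aug F \<bullet> v \<in> I" by blast
  from choice[OF this] obtain w where w: "\<And>q. w q \<in> carrier_vec (rank F 0)"
      "\<And>q. aug M $ q - aug F \<bullet> w q \<in> I"
    by blast
  define A where "A = mat (rank F 0) (rank M 0) (\<lambda>(p, q). graded_part (shift M 0 q - shift F 0 p) (w q $ p))"
  have A: "A \<in> carrier_mat (rank F 0) (rank M 0)" by (simp add: A_def)
  have hF: "homogeneous (shift F 0 p) (aug F $ p)" if "p < rank F 0" for p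
    using resolution_augmentation(1)[OF F that] .
  have hM: "homogeneous (shift M 0 p) (aug M $ p)" if "p < rank M 0" for p
    using resolution_augmentation(1)[OF M that] .
  have "aug M $ q - aug F \<bullet> col A q = graded_part (shift M 0 q) (aug M $ q - aug F \<bullet> w q)"
    if q: "q < rank M 0" for q
  proof -
    have "graded_part (shift M 0 q) (aug F \<bullet> w q)
        = (\<Sum>p = 0..<rank F 0. graded_part (shift M 0 q) (aug F $ p * w q $ p))"
      using w(1)[of q] by (simp add: scalar_prod_def graded_part_sum)
    also have "\<dots> = (\<Sum>p = 0..<rank F 0. aug F $ p * A $$ (p, q))"
      using q by (intro sum.cong refl) (simp add: A_def graded_part_times[OF hF])
    also have "\<dots> = aug F \<bullet> col A q"
      using A q by (simp add: scalar_prod_def)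
    finally show ?thesis using hM[OF q] by (simp add: graded_part_diff graded_part_id)
  qed
  then have "\<forall>q<rank M 0. aug M $ q - aug F \<bullet> col A q \<in> I"
    using w(2) gI unfolding graded_set_def by metis
  moreover have "homogeneous_mat (shift F 0) (shift M 0) A"
    unfolding homogeneous_mat_def A_def by (simp add: graded_part_homogeneous)
  ultimately show ?thesis using A by blast
qed

definition chain_map ::
  "('v::finite, 'k::field) mpoly set \<Rightarrow> ('v, 'k) mpoly free_complex \<Rightarrow> ('v, 'k) mpoly free_complex
    \<Rightarrow> (nat \<Rightarrow> ('v, 'k) mpoly mat) \<Rightarrow> bool" where
  "chain_map I M F \<phi> \<longleftrightarrow>
     (\<forall>i. \<phi> i \<in> carrier_mat (rank F i) (rank M i)) \<and>
     (\<forall>i. homogeneous_mat (shift F i) (shift M i) (\<phi> i)) \<and>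
     (\<forall>q<rank M 0. aug M $ q - aug F \<bullet> col (\<phi> 0) q \<in> I) \<and>
     (\<forall>i. diff F i * \<phi> (Suc i) = \<phi> i * diff M i)"

text \<open>
  The comparison map is built degree by degree: \<open>\<phi> i * diff M i\<close> is annihilated by the differential
  of \<open>F\<close>, so it factors through the next one, and the factor is \<open>\<phi> (i + 1)\<close>.
\<close>

lemma chain_map_exists:
  fixes F M :: "('v::finite, 'k::field) mpoly free_complex"
  assumes I: "ring_ideal I" and gI: "graded_set I"
    and F: "graded_free_resolution I F" and M: "graded_free_resolution I M"
  shows "\<exists>\<phi>. chain_map I M F \<phi>"
proof -
  note cF = resolution_carrier[OF F] and cM = resolution_carrier[OF M]
  \<comment> \<open>the invariant looks one step ahead: the next map exists\<close>
  define P where "P i A \<longleftrightarrow> A \<in> carrier_mat (rank F i) (rank M i) \<and>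
      homogeneous_mat (shift F i) (shift M i) A \<and>
      (i = 0 \<longrightarrow> (\<forall>q<rank M 0. aug M $ q - aug F \<bullet> col A q \<in> I)) \<and>
      (\<exists>B\<in>carrier_mat (rank F (Suc i)) (rank M (Suc i)).
         homogeneous_mat (shift F (Suc i)) (shift M (Suc i)) B \<and> diff F i * B = A * diff M i)" for i A
  have "\<exists>\<phi>. \<forall>i. P i (\<phi> i) \<and> diff F i * \<phi> (Suc i) = \<phi> i * diff M i"
  proof (rule dependent_nat_choice)
    obtain A where A: "A \<in> carrier_mat (rank F 0) (rank M 0)"
      and hA: "homogeneous_mat (shift F 0) (shift M 0) A"
      and aA: "\<forall>q<rank M 0. aug M $ q - aug F \<bullet> col A q \<in> I"
      using lift_augmentation[OF gI F M] by blast
    have AM: "A * diff M 0 \<in> carrier_mat (rank F 0) (rank M (Suc 0))"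
      using A cM(2) by (rule mult_carrier_mat)
    have "\<exists>B\<in>carrier_mat (rank F (Suc 0)) (rank M (Suc 0)). A * diff M 0 = diff F 0 * B"
    proof (rule factor_columns[OF cF(2) AM])
      fix q assume q: "q < rank M (Suc 0)"
      let ?u = "col (diff M 0) q"
      have u: "?u \<in> carrier_vec (rank M 0)" using cM(2)[of 0] q by auto
      have "?u = diff M 0 *\<^sub>v unit_vec (rank M (Suc 0)) q"
        using cM(2)[of 0] q by (intro eq_vecI) auto
      then have "?u \<in> (\<lambda>w. diff M 0 *\<^sub>v w) ` carrier_vec (rank M 1)" by auto
      with u have "aug M \<bullet> ?u \<in> I" using resolution_augmentation(3)[OF M] by blast
      moreover have "aug M \<bullet> ?u - aug F \<bullet> (A *\<^sub>v ?u) \<in> I"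
        by (rule augmentation_apply[OF I cM(1) cF(1) A u]) (use aA in blast)
      ultimately have "aug M \<bullet> ?u - (aug M \<bullet> ?u - aug F \<bullet> (A *\<^sub>v ?u)) \<in> I"
        using I ring_ideal_diff by blast
      then have "aug F \<bullet> (A *\<^sub>v ?u) \<in> I" by simp
      moreover have "A *\<^sub>v ?u \<in> carrier_vec (rank F 0)" using A u by simp
      ultimately have "A *\<^sub>v ?u \<in> (\<lambda>w. diff F 0 *\<^sub>v w) ` carrier_vec (rank F 1)"
        using resolution_augmentation(3)[OF F] by blast
      moreover have "col (A * diff M 0) q = A *\<^sub>v ?u"
        using A cM(2) q by (rule col_mult2)
      ultimately show "col (A * diff M 0) q \<in> (\<lambda>w. diff F 0 *\<^sub>v w) ` carrier_vec (rank F (Suc 0))"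
        by simp
    qed
    then obtain B where B: "B \<in> carrier_mat (rank F (Suc 0)) (rank M (Suc 0))"
      and e: "A * diff M 0 = diff F 0 * B" by blast
    have "homogeneous_mat (shift F 0) (shift M (Suc 0)) (diff F 0 * B)"
      using homogeneous_mat_mult[OF A cM(2) hA resolution_homogeneous[OF M]] e by simp
    from homogeneous_factor[OF cF(2) B resolution_homogeneous[OF F] this]
    obtain B' where B': "B' \<in> carrier_mat (rank F (Suc 0)) (rank M (Suc 0))"
      and hB': "homogeneous_mat (shift F (Suc 0)) (shift M (Suc 0)) B'"
      and e': "diff F 0 * B = diff F 0 * B'" by blast
    have "diff F 0 * B' = A * diff M 0" using e e' by simp
    with A hA aA B' hB' have "P 0 A" unfolding P_def by blast
    then show "\<exists>A. P 0 A" by blast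
  next
    fix A i assume "P i A"
    then obtain B where A: "A \<in> carrier_mat (rank F i) (rank M i)"
      and B: "B \<in> carrier_mat (rank F (Suc i)) (rank M (Suc i))"
      and hB: "homogeneous_mat (shift F (Suc i)) (shift M (Suc i)) B"
      and e: "diff F i * B = A * diff M i"
      unfolding P_def by blast
    have BM: "B * diff M (Suc i) \<in> carrier_mat (rank F (Suc i)) (rank M (Suc (Suc i)))"
      using B cM(2) by (rule mult_carrier_mat)
    have "diff F i * (B * diff M (Suc i)) = (A * diff M i) * diff M (Suc i)"
      using assoc_mult_mat[OF cF(2) B cM(2)] e by simp
    also have "\<dots> = A * (diff M i * diff M (Suc i))"
      using A cM(2) cM(2) by (rule assoc_mult_mat)
    also have "\<dots> = 0\<^sub>m (rank F i) (rank M (Suc (Suc i)))"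
      using A by (simp add: resolution_complex[OF M])
    finally have z: "diff F i * (B * diff M (Suc i)) = 0\<^sub>m (rank F i) (rank M (Suc (Suc i)))" .
    have "homogeneous_mat (shift F (Suc i)) (shift M (Suc (Suc i))) (B * diff M (Suc i))"
      using B cM(2) hB resolution_homogeneous[OF M] by (rule homogeneous_mat_mult)
    from resolution_exact_homogeneous[OF F BM z this]
    have "P (Suc i) B" using B hB by (auto simp: P_def)
    with e show "\<exists>B. P (Suc i) B \<and> diff F i * B = A * diff M i" by blast
  qed
  then obtain \<phi> where \<phi>: "\<And>i. P i (\<phi> i)" "\<And>i. diff F i * \<phi> (Suc i) = \<phi> i * diff M i" by blast
  then have "chain_map I M F \<phi>" by (auto simp: chain_map_def P_def)
  then show ?thesis by blast
qed

lemma constant_coeff_mult: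
  fixes A B :: "('v, 'k::field) mpoly mat"
  assumes "A \<in> carrier_mat n r" "B \<in> carrier_mat r k" "p < n" "q < k"
  shows "lookup ((A * B) $$ (p, q)) 0 = (\<Sum>l = 0..<r. lookup (A $$ (p, l)) 0 * lookup (B $$ (l, q)) 0)"
  using assms by (simp add: scalar_prod_def lookup_sum lookup_times_zero)

text \<open>
  A chain endomorphism that induces zero on \<open>R/I\<close> is null-homotopic, that is, \<open>\<theta>\<close> at position \<open>i\<close> is
  \<open>d h + h' d\<close> with \<open>h'\<close> the homotopy one position lower. Both summands have constant coefficients zero
  when the entries of the differentials do. The induction carries along a homotopy \<open>h\<close> with
  \<open>(\<theta> - d h) d = 0\<close>, which is what makes the equation for the next one solvable.
\<close>

lemma endomorphism_of_minimal:
  fixes M :: "('v::finite, 'k::field) mpoly free_complex"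
  assumes I: "ring_ideal I" and M: "minimal_graded_free_resolution I M"
    and c: "\<And>i. \<theta> i \<in> carrier_mat (rank M i) (rank M i)"
    and a: "\<And>q. q < rank M 0 \<Longrightarrow> aug M \<bullet> col (\<theta> 0) q \<in> I"
    and ch: "\<And>i. diff M i * \<theta> (Suc i) = \<theta> i * diff M i"
    and pq: "p < rank M i" "q < rank M i"
  shows "lookup (\<theta> i $$ (p, q)) 0 = 0"
proof -
  have res: "graded_free_resolution I M"
    using M by (simp add: minimal_graded_free_resolution_def)
  note cM = resolution_carrier[OF res]
  have min: "lookup (diff M i $$ (p, q)) 0 = 0" if "p < rank M i" "q < rank M (Suc i)" for i p q
    using M that by (auto simp: minimal_graded_free_resolution_def)
  have dh0: "lookup ((diff M i * h) $$ (p, q)) 0 = 0"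
    if "h \<in> carrier_mat (rank M (Suc i)) k" "p < rank M i" "q < k" for i h p q k
    using constant_coeff_mult[OF cM(2) that(1,2,3)] that(2) by (simp add: min)
  have hd0: "lookup ((h * diff M i) $$ (p, q)) 0 = 0"
    if "h \<in> carrier_mat k (rank M i)" "p < k" "q < rank M (Suc i)" for i h p q k
    using constant_coeff_mult[OF that(1) cM(2) that(2,3)] that(3) by (simp add: min)
  have "(\<forall>p<rank M i. \<forall>q<rank M i. lookup (\<theta> i $$ (p, q)) 0 = 0) \<and>
    (\<exists>h\<in>carrier_mat (rank M (Suc i)) (rank M i).
       (\<theta> i - diff M i * h) * diff M i = 0\<^sub>m (rank M i) (rank M (Suc i)))" for i
  proof (induction i)
    case 0
    have "\<exists>h\<in>carrier_mat (rank M (Suc 0)) (rank M 0). \<theta> 0 = diff M 0 * h"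
    proof (rule factor_columns[OF cM(2) c])
      fix q assume q: "q < rank M 0"
      have "col (\<theta> 0) q \<in> carrier_vec (rank M 0)" using c[of 0] q by auto
      with a[OF q] show "col (\<theta> 0) q \<in> (\<lambda>w. diff M 0 *\<^sub>v w) ` carrier_vec (rank M (Suc 0))"
        using resolution_augmentation(3)[OF res] by simp
    qed
    then obtain h where h: "h \<in> carrier_mat (rank M (Suc 0)) (rank M 0)" and e: "\<theta> 0 = diff M 0 * h"
      by blast
    have "\<theta> 0 - diff M 0 * h = 0\<^sub>m (rank M 0) (rank M 0)"
      using c[of 0] by (simp flip: e)
    then have "(\<theta> 0 - diff M 0 * h) * diff M 0 = 0\<^sub>m (rank M 0) (rank M (Suc 0))"
      using cM(2)[of 0] by simp
    moreover have "lookup (\<theta> 0 $$ (p, q)) 0 = 0" if "p < rank M 0" "q < rank M 0" for p q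
      unfolding e by (rule dh0[OF h that])
    ultimately show ?case using h by blast
  next
    case (Suc i)
    then obtain h where h: "h \<in> carrier_mat (rank M (Suc i)) (rank M i)"
      and z: "(\<theta> i - diff M i * h) * diff M i = 0\<^sub>m (rank M i) (rank M (Suc i))" by blast
    let ?\<eta> = "\<theta> (Suc i) - h * diff M i"
    have hd: "h * diff M i \<in> carrier_mat (rank M (Suc i)) (rank M (Suc i))"
      using h cM(2) by (rule mult_carrier_mat)
    have dh: "diff M i * h \<in> carrier_mat (rank M i) (rank M i)"
      using cM(2) h by (rule mult_carrier_mat)
    have \<eta>: "?\<eta> \<in> carrier_mat (rank M (Suc i)) (rank M (Suc i))"
      using hd by (rule minus_carrier_mat)
    have "diff M i * ?\<eta> = diff M i * \<theta> (Suc i) - diff M i * (h * diff M i)"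
      using cM(2) c hd by (rule mult_minus_distrib_mat)
    also have "\<dots> = \<theta> i * diff M i - (diff M i * h) * diff M i"
      using assoc_mult_mat[OF cM(2) h cM(2)] ch by simp
    also have "\<dots> = (\<theta> i - diff M i * h) * diff M i"
      using minus_mult_distrib_mat[OF c dh cM(2)] by simp
    finally have "diff M i * ?\<eta> = 0\<^sub>m (rank M i) (rank M (Suc i))" using z by simp
    from resolution_exact[OF res \<eta> this]
    obtain g where g: "g \<in> carrier_mat (rank M (Suc (Suc i))) (rank M (Suc i))"
      and e: "?\<eta> = diff M (Suc i) * g" by blast
    have dg: "diff M (Suc i) * g \<in> carrier_mat (rank M (Suc i)) (rank M (Suc i))"
      using cM(2) g by (rule mult_carrier_mat)
    have sp: "\<theta> (Suc i) = h * diff M i + diff M (Suc i) * g"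
      unfolding e[symmetric] using hd c[of "Suc i"] by (intro eq_matI) auto
    from mat_add_diff_cancel[OF hd dg] have "\<theta> (Suc i) - diff M (Suc i) * g = h * diff M i"
      by (simp only: sp)
    then have "(\<theta> (Suc i) - diff M (Suc i) * g) * diff M (Suc i)
        = h * (diff M i * diff M (Suc i))"
      using assoc_mult_mat[OF h cM(2) cM(2)] by simp
    also have "\<dots> = 0\<^sub>m (rank M (Suc i)) (rank M (Suc (Suc i)))"
      using h by (simp add: resolution_complex[OF res])
    finally have "(\<theta> (Suc i) - diff M (Suc i) * g) * diff M (Suc i)
        = 0\<^sub>m (rank M (Suc i)) (rank M (Suc (Suc i)))" .
    moreover have "lookup (\<theta> (Suc i) $$ (p, q)) 0 = 0" if pq: "p < rank M (Suc i)" "q < rank M (Suc i)" for p q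
    proof -
      have "\<theta> (Suc i) $$ (p, q) = (h * diff M i) $$ (p, q) + (diff M (Suc i) * g) $$ (p, q)"
        unfolding sp using dg pq by (intro index_add_mat(1)) auto
      then show ?thesis by (simp only: lookup_add hd0[OF h pq] dh0[OF g pq] add_0)
    qed
    ultimately show ?case using g by blast
  qed
  with pq show ?thesis by blast
qed

text \<open>
  The composite of comparison maps \<open>\<phi>\<close> from \<open>M\<close> to \<open>F\<close> and \<open>\<psi>\<close> back is the identity modulo the
  variables, by the preceding lemma. So in column \<open>q\<close> of \<open>\<phi>\<close> some entry has a nonzero constant
  coefficient, and a homogeneous entry of that kind joins basis elements of equal degree.
\<close>

lemma minimal_shift_occurs:
  fixes F M :: "('v::finite, 'k::field) mpoly free_complex"
  assumes I: "ring_ideal I" and gI: "graded_set I"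
    and M: "minimal_graded_free_resolution I M" and F: "graded_free_resolution I F"
    and q: "q < rank M i"
  shows "\<exists>p<rank F i. shift F i p = shift M i q"
proof -
  have res: "graded_free_resolution I M"
    using M by (simp add: minimal_graded_free_resolution_def)
  note cM = resolution_carrier[OF res] and cF = resolution_carrier[OF F]
  obtain \<phi> where \<phi>: "chain_map I M F \<phi>" using chain_map_exists[OF I gI F res] by blast
  obtain \<psi> where \<psi>: "chain_map I F M \<psi>" using chain_map_exists[OF I gI res F] by blast
  have c\<phi>: "\<phi> i \<in> carrier_mat (rank F i) (rank M i)"
    and h\<phi>: "homogeneous_mat (shift F i) (shift M i) (\<phi> i)"
    and d\<phi>: "diff F i * \<phi> (Suc i) = \<phi> i * diff M i" for i
    using \<phi> by (auto simp: chain_map_def)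
  have c\<psi>: "\<psi> i \<in> carrier_mat (rank M i) (rank F i)"
    and d\<psi>: "diff M i * \<psi> (Suc i) = \<psi> i * diff F i" for i
    using \<psi> by (auto simp: chain_map_def)
  define \<theta> where "\<theta> i = \<psi> i * \<phi> i - 1\<^sub>m (rank M i)" for i
  have c\<psi>\<phi>: "\<psi> i * \<phi> i \<in> carrier_mat (rank M i) (rank M i)" for i
    using c\<psi> c\<phi> by (rule mult_carrier_mat)
  have c\<theta>: "\<theta> i \<in> carrier_mat (rank M i) (rank M i)" for i
    unfolding \<theta>_def by (rule minus_carrier_mat) simp
  have "lookup (\<theta> i $$ (q, q)) 0 = 0"
  proof (rule endomorphism_of_minimal[OF I M c\<theta> _ _ q q])
    fix q assume q: "q < rank M 0"
    have u: "col (\<phi> 0) q \<in> carrier_vec (rank F 0)" using c\<phi>[of 0] q by auto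
    have "aug F \<bullet> col (\<phi> 0) q - aug M \<bullet> (\<psi> 0 *\<^sub>v col (\<phi> 0) q) \<in> I"
      by (rule augmentation_apply[OF I cF(1) cM(1) c\<psi> u]) (use \<psi> in \<open>auto simp: chain_map_def\<close>)
    moreover have "aug M $ q - aug F \<bullet> col (\<phi> 0) q \<in> I"
      using \<phi> q by (auto simp: chain_map_def)
    ultimately have "(aug F \<bullet> col (\<phi> 0) q - aug M \<bullet> (\<psi> 0 *\<^sub>v col (\<phi> 0) q))
        + (aug M $ q - aug F \<bullet> col (\<phi> 0) q) \<in> I"
      using I ring_ideal_add by blast
    then have "aug M $ q - aug M \<bullet> (\<psi> 0 *\<^sub>v col (\<phi> 0) q) \<in> I" by simp
    then have neg: "- 1 * (aug M $ q - aug M \<bullet> (\<psi> 0 *\<^sub>v col (\<phi> 0) q)) \<in> I"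
      using I ring_ideal_mult by blast
    from col_minus_one[OF c\<psi>\<phi> q]
    have "col (\<theta> 0) q = col (\<psi> 0 * \<phi> 0) q - unit_vec (rank M 0) q"
      by (simp only: \<theta>_def)
    also have "col (\<psi> 0 * \<phi> 0) q = \<psi> 0 *\<^sub>v col (\<phi> 0) q"
      using c\<psi> c\<phi> q by (rule col_mult2)
    finally have "aug M \<bullet> col (\<theta> 0) q
        = aug M \<bullet> (\<psi> 0 *\<^sub>v col (\<phi> 0) q) - aug M \<bullet> unit_vec (rank M 0) q"
      using scalar_prod_minus_distrib[OF cM(1), of "\<psi> 0 *\<^sub>v col (\<phi> 0) q" "unit_vec (rank M 0) q"]
        mult_mat_vec_carrier[OF c\<psi> u] by simp
    also have "\<dots> = - 1 * (aug M $ q - aug M \<bullet> (\<psi> 0 *\<^sub>v col (\<phi> 0) q))"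
      using cM(1) q by simp
    finally show "aug M \<bullet> col (\<theta> 0) q \<in> I" using neg by simp
  next
    fix i
    have "diff M i * \<theta> (Suc i) = diff M i * (\<psi> (Suc i) * \<phi> (Suc i)) - diff M i * 1\<^sub>m (rank M (Suc i))"
      unfolding \<theta>_def using cM(2) c\<psi>\<phi> one_carrier_mat by (rule mult_minus_distrib_mat)
    also have "diff M i * (\<psi> (Suc i) * \<phi> (Suc i)) = (diff M i * \<psi> (Suc i)) * \<phi> (Suc i)"
      using assoc_mult_mat[OF cM(2) c\<psi> c\<phi>] by simp
    also have "\<dots> = \<psi> i * (\<phi> i * diff M i)"
      unfolding d\<psi> using assoc_mult_mat[OF c\<psi> cF(2) c\<phi>] by (simp add: d\<phi>)
    also have "\<dots> = (\<psi> i * \<phi> i) * diff M i"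
      using assoc_mult_mat[OF c\<psi> c\<phi> cM(2)] by simp
    also have "diff M i * 1\<^sub>m (rank M (Suc i)) = 1\<^sub>m (rank M i) * diff M i"
      using cM(2)[of i] by simp
    also have "(\<psi> i * \<phi> i) * diff M i - 1\<^sub>m (rank M i) * diff M i = \<theta> i * diff M i"
      unfolding \<theta>_def using minus_mult_distrib_mat[OF c\<psi>\<phi> one_carrier_mat cM(2)] by simp
    finally show "diff M i * \<theta> (Suc i) = \<theta> i * diff M i" .
  qed
  moreover have "\<theta> i $$ (q, q) = (\<psi> i * \<phi> i) $$ (q, q) - 1"
    unfolding \<theta>_def using c\<psi>\<phi>[of i] q by simp
  ultimately have "lookup ((\<psi> i * \<phi> i) $$ (q, q)) 0 = 1"
    by (simp add: lookup_minus)
  then have "(\<Sum>l = 0..<rank F i. lookup (\<psi> i $$ (q, l)) 0 * lookup (\<phi> i $$ (l, q)) 0) = 1"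
    using constant_coeff_mult[OF c\<psi> c\<phi> q q] by simp
  then obtain l where l: "l < rank F i" and nz: "lookup (\<phi> i $$ (l, q)) 0 \<noteq> 0"
    by (metis (no_types, lifting) atLeastLessThan_iff mult_zero_right sum.neutral zero_neq_one)
  have "homogeneous (shift M i q - shift F i l) (\<phi> i $$ (l, q))"
    using h\<phi>[of i] c\<phi>[of i] l q by (auto simp: homogeneous_mat_def)
  with nz have "shift F i l = shift M i q"
    by (force simp: homogeneous_def in_keys_iff)
  with l show ?thesis by blast
qed

text \<open>
  Two minimal resolutions have the same shifts, so the chosen resolution behind \<open>graded_betti\<close> may be
  replaced by any other when only the vanishing of the Betti number matters.
\<close>

lemma graded_betti_nonzero_iff:
  fixes M :: "('v::finite, 'k::field) mpoly free_complex"
  assumes I: "ring_ideal I" and gI: "graded_set I" and M: "minimal_graded_free_resolution I M"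
  shows "graded_betti I i j \<noteq> 0 \<longleftrightarrow> (\<exists>q<rank M i. shift M i q = j)"
proof -
  have ex: "\<exists>b. \<exists>F. minimal_graded_free_resolution I F \<and> b = card {q. q < rank F i \<and> shift F i q = j}"
    using M by blast
  obtain F where F: "minimal_graded_free_resolution I F"
    and b: "graded_betti I i j = card {q. q < rank F i \<and> shift F i q = j}"
    using someI_ex[OF ex] unfolding graded_betti_def by blast
  have res: "graded_free_resolution I M" "graded_free_resolution I F"
    using M F by (auto simp: minimal_graded_free_resolution_def)
  have "graded_betti I i j \<noteq> 0 \<longleftrightarrow> (\<exists>q<rank F i. shift F i q = j)"
    unfolding b by (subst card_0_eq) auto
  with minimal_shift_occurs[OF I gI M res(2)] minimal_shift_occurs[OF I gI F res(1)]
  show ?thesis by metis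
qed

section \<open>Minimal generators of multigraded submodules\<close>

text \<open>
  The part in multidegree \<open>b\<close> of the free module whose basis elements, indexed by \<open>A\<close>, have the
  multidegrees \<open>d\<close>: the function \<open>x\<close> stands for the vector with entries \<open>x q\<close> times the monomial with
  exponent \<open>b - d q\<close>. Index sets are used in place of ranks so that a generator can be removed without
  renumbering the others.
\<close>

definition strand :: "nat set \<Rightarrow> (nat \<Rightarrow> 'v \<Rightarrow>\<^sub>0 nat) \<Rightarrow> ('v \<Rightarrow>\<^sub>0 nat) \<Rightarrow> (nat \<Rightarrow> 'k::field) set" where
  "strand A d b = {x. \<forall>q. x q \<noteq> 0 \<longrightarrow> q \<in> A \<and> d q \<preceq> b}"

definition combine :: "nat set \<Rightarrow> (nat \<Rightarrow> nat \<Rightarrow> 'k::field) \<Rightarrow> (nat \<Rightarrow> 'k) \<Rightarrow> nat \<Rightarrow> 'k" where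
  "combine A c x = (\<lambda>p. \<Sum>q\<in>A. c p q * x q)"

text \<open>
  A multigraded submodule of a free module, given by its multigraded parts. Multiplication by a
  monomial does not change the scalars, so closure under it becomes monotonicity in the
  multidegree.
\<close>

definition submodule_family ::
  "nat \<Rightarrow> (nat \<Rightarrow> 'v \<Rightarrow>\<^sub>0 nat) \<Rightarrow> (('v \<Rightarrow>\<^sub>0 nat) \<Rightarrow> (nat \<Rightarrow> 'k::field) set) \<Rightarrow> bool" where
  "submodule_family n a Z \<longleftrightarrow>
     (\<forall>b. Z b \<subseteq> strand {..<n} a b) \<and>
     (\<forall>b. (\<lambda>_. 0) \<in> Z b) \<and>
     (\<forall>b x y s. x \<in> Z b \<longrightarrow> y \<in> Z b \<longrightarrow> (\<lambda>p. x p + s * y p) \<in> Z b) \<and>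
     (\<forall>b b'. b \<preceq> b' \<longrightarrow> Z b \<subseteq> Z b')"

lemma combine_zero [simp]: "combine A c (\<lambda>_. 0) = (\<lambda>_. 0)"
  by (simp add: combine_def)

lemma combine_linear: "combine A c (\<lambda>q. x q + s * y q) = (\<lambda>p. combine A c x p + s * combine A c y p)"
  by (simp add: combine_def algebra_simps sum.distrib sum_distrib_left)

lemma submodule_family_sum:
  assumes Z: "submodule_family n a Z" and "finite A" and "\<And>q. q \<in> A \<Longrightarrow> x q \<noteq> 0 \<Longrightarrow> (\<lambda>p. c p q) \<in> Z b"
  shows "combine A c x \<in> Z b"
  using assms(2,3)
proof (induction A rule: finite_induct)
  case empty
  then show ?case using Z by (simp add: combine_def submodule_family_def)
next
  case (insert q A)
  from insert.IH insert.prems have IH: "combine A c x \<in> Z b" by blast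
  have e: "combine (insert q A) c x = (\<lambda>p. combine A c x p + x q * c p q)"
    using insert.hyps by (simp add: combine_def add.commute mult.commute)
  show ?case
  proof (cases "x q = 0")
    case True
    then show ?thesis using IH by (simp add: e)
  next
    case False
    then have "(\<lambda>p. c p q) \<in> Z b" using insert.prems by blast
    then show ?thesis unfolding e using IH Z unfolding submodule_family_def by blast
  qed
qed

lemma nat_sequence_mono_subseq:
  fixes g :: "nat \<Rightarrow> nat"
  shows "\<exists>r::nat \<Rightarrow> nat. strict_mono r \<and> mono (g \<circ> r)"
proof -
  have "\<exists>j\<ge>k. \<forall>i\<ge>k. g j \<le> g i" for k
    using arg_min_natI[of "\<lambda>i. k \<le> i" k g] arg_min_nat_le[of "\<lambda>i. k \<le> i" _ g] by blast
  then have "\<forall>k. \<exists>j. k \<le> j \<and> (\<forall>i\<ge>k. g j \<le> g i)" by blast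
  from choice[OF this] obtain h where h: "\<And>k. k \<le> h k" "\<And>k i. k \<le> i \<Longrightarrow> g (h k) \<le> g i"
    by blast
  define t where "t = rec_nat (h 0) (\<lambda>_ k. h (Suc k))"
  have t: "t 0 = h 0" "t (Suc i) = h (Suc (t i))" for i
    by (simp_all add: t_def)
  have st: "t i < t (Suc i)" for i
    using h(1)[of "Suc (t i)"] by (simp add: t)
  have "g (t i) \<le> g (t (Suc i))" for i
  proof (cases i)
    case 0
    show ?thesis unfolding 0 t(1) by (rule h(2)) simp
  next
    case (Suc j)
    have "Suc (t j) \<le> t (Suc (Suc j))" using st[of j] st[of "Suc j"] by simp
    then show ?thesis unfolding Suc by (subst t(2)) (rule h(2))
  qed
  then have "mono (g \<circ> t)" by (simp add: mono_iff_le_Suc)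
  moreover have "strict_mono t" using st by (simp add: strict_mono_Suc_iff)
  ultimately show ?thesis by blast
qed

text \<open>
  Dickson's lemma, obtained by refining a subsequence for one variable after another.
\<close>

lemma exponent_sequence_mono_subseq:
  fixes f :: "nat \<Rightarrow> ('v::finite \<Rightarrow>\<^sub>0 nat)"
  shows "\<exists>r::nat \<Rightarrow> nat. strict_mono r \<and> (\<forall>i j. i \<le> j \<longrightarrow> f (r i) \<preceq> f (r j))"
proof -
  have "\<exists>r::nat \<Rightarrow> nat. strict_mono r \<and> (\<forall>v\<in>A. mono (\<lambda>i. lookup (f (r i)) v))"
    if "finite A" for A :: "'v set"
    using that
  proof (induction A rule: finite_induct)
    case empty
    show ?case by (intro exI[of _ id]) (auto simp: strict_mono_def)
  next
    case (insert w A)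
    then obtain r :: "nat \<Rightarrow> nat" where r: "strict_mono r"
      and m: "\<And>v. v \<in> A \<Longrightarrow> mono (\<lambda>i. lookup (f (r i)) v)" by blast
    obtain t :: "nat \<Rightarrow> nat" where t: "strict_mono t" and w: "mono ((\<lambda>i. lookup (f (r i)) w) \<circ> t)"
      using nat_sequence_mono_subseq by blast
    have "mono (\<lambda>i. lookup (f ((r \<circ> t) i)) v)" if "v \<in> insert w A" for v
    proof (cases "v = w")
      case True
      then show ?thesis using w by (simp add: comp_def)
    next
      case False
      then have "mono (\<lambda>i. lookup (f (r i)) v)" using that m by blast
      then show ?thesis using strict_mono_mono[OF t] by (simp add: mono_def)
    qed
    moreover have "strict_mono (r \<circ> t)" using r t by (rule strict_mono_o)
    ultimately show ?case by blast
  qed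
  from this[of UNIV] obtain r :: "nat \<Rightarrow> nat"
    where r: "strict_mono r" and m: "\<And>v. mono (\<lambda>i. lookup (f (r i)) v)" by auto
  have "f (r i) \<preceq> f (r j)" if "i \<le> j" for i j
    unfolding mdvd_def using monoD[OF m that] by blast
  with r show ?thesis by blast
qed

text \<open>
  Some vector of an infinite sequence of vectors of length \<open>n\<close> depends linearly on its predecessors.
  In the induction the last coordinate is eliminated with the help of a vector \<open>y k0\<close> in which it does
  not vanish.
\<close>

lemma linear_dependence:
  fixes y :: "nat \<Rightarrow> nat \<Rightarrow> 'k::field"
  shows "\<exists>k l. \<forall>p<n. y k p = (\<Sum>i<k. l i * y i p)"
proof (induction n arbitrary: y)
  case 0
  show ?case by simp
next
  case (Suc n)
  show ?case
  proof (cases "\<forall>k. y k n = 0")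
    case True
    obtain k l where "\<forall>p<n. y k p = (\<Sum>i<k. l i * y i p)" using Suc by blast
    with True have "\<forall>p<Suc n. y k p = (\<Sum>i<k. l i * y i p)" by (auto simp: less_Suc_eq)
    then show ?thesis by blast
  next
    case False
    then obtain k0 where k0: "y k0 n \<noteq> 0" by auto
    define t where "t k = y (Suc k0 + k) n / y k0 n" for k
    obtain k l where kl: "\<forall>p<n. y (Suc k0 + k) p - t k * y k0 p
        = (\<Sum>i<k. l i * (y (Suc k0 + i) p - t i * y k0 p))"
      using Suc[of "\<lambda>k p. y (Suc k0 + k) p - t k * y k0 p"] by blast
    \<comment> \<open>the coefficient of \<open>y k0\<close> collects what the elimination subtracted\<close>
    define l' where "l' j = (if j < k0 then 0 else if j = k0 then t k - (\<Sum>i<k. l i * t i)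
        else l (j - Suc k0))" for j
    have "(\<Sum>j<Suc k0 + k. l' j * y j p) = t k * y k0 p + (\<Sum>i<k. l i * (y (Suc k0 + i) p - t i * y k0 p))"
      for p
    proof -
      have "(\<Sum>j<Suc k0 + k. l' j * y j p)
          = (\<Sum>j<Suc k0. l' j * y j p) + (\<Sum>i<k. l' (Suc k0 + i) * y (Suc k0 + i) p)"
        by (induction k) simp_all
      also have "(\<Sum>j<Suc k0. l' j * y j p) = (t k - (\<Sum>i<k. l i * t i)) * y k0 p"
        by (simp add: l'_def)
      also have "(\<Sum>i<k. l' (Suc k0 + i) * y (Suc k0 + i) p) = (\<Sum>i<k. l i * y (Suc k0 + i) p)"
        by (simp add: l'_def)
      finally show ?thesis
        by (simp add: left_diff_distrib right_diff_distrib sum_subtractf sum_distrib_right mult.assoc)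
    qed
    moreover have "y (Suc k0 + k) p
        = t k * y k0 p + (\<Sum>i<k. l i * (y (Suc k0 + i) p - t i * y k0 p))"
      if p: "p < Suc n" for p
    proof (cases "p < n")
      case True
      from kl[rule_format, OF this] show ?thesis by (simp only: diff_eq_eq add.commute)
    next
      case False
      with p have "p = n" by simp
      then show ?thesis using k0 by (simp add: t_def)
    qed
    ultimately have "\<forall>p<Suc n. y (Suc k0 + k) p = (\<Sum>j<Suc k0 + k. l' j * y j p)"
      by metis
    then show ?thesis by blast
  qed
qed

definition generates ::
  "nat set \<Rightarrow> (nat \<Rightarrow> 'v \<Rightarrow>\<^sub>0 nat) \<Rightarrow> (nat \<Rightarrow> nat \<Rightarrow> 'k::field)
    \<Rightarrow> (('v \<Rightarrow>\<^sub>0 nat) \<Rightarrow> (nat \<Rightarrow> 'k) set) \<Rightarrow> bool" where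
  "generates A d c Z \<longleftrightarrow> finite A \<and> (\<forall>b. combine A c ` strand A d b = Z b)"

text \<open>
  Otherwise there is an infinite sequence of homogeneous elements none of which lies in the submodule
  generated by its predecessors. Along a subsequence the multidegrees increase. A linear dependence
  among the scalar vectors of that subsequence can then be multiplied up by monomials into one
  multidegree, where it expresses an element through its predecessors.
\<close>

lemma finitely_generated:
  fixes Z :: "('v::finite \<Rightarrow>\<^sub>0 nat) \<Rightarrow> (nat \<Rightarrow> 'k::field) set"
  assumes Z: "submodule_family n a Z"
  shows "\<exists>A d c. generates A d c Z \<and> (\<forall>q\<in>A. (\<lambda>p. c p q) \<in> Z (d q))"
proof (rule ccontr)
  assume "\<not> ?thesis"
  then have nfg: False if "generates A d c Z" "\<And>q. q \<in> A \<Longrightarrow> (\<lambda>p. c p q) \<in> Z (d q)" for A d c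
    using that by blast
  have mono: "Z b \<subseteq> Z b'" if "b \<preceq> b'" for b b' using Z that by (auto simp: submodule_family_def)
  \<comment> \<open>\<open>r\<close> is an element, with its multidegree, that the first \<open>s\<close> elements of \<open>g\<close> do not generate\<close>
  define P where "P g s r \<longleftrightarrow> snd r \<in> Z (fst r) \<and>
      snd r \<notin> combine {..<s} (\<lambda>p q. snd (g q) p) ` strand {..<s} (\<lambda>q. fst (g q)) (fst r)"
    for g :: "nat \<Rightarrow> ('v \<Rightarrow>\<^sub>0 nat) \<times> (nat \<Rightarrow> 'k)" and s :: nat and r
  have "\<exists>g. \<forall>s. P g s (g s)"
  proof (rule dependent_wf_choice[OF wf_less])
    fix f g :: "nat \<Rightarrow> ('v \<Rightarrow>\<^sub>0 nat) \<times> (nat \<Rightarrow> 'k)" and s r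
    assume "\<And>z. (z, s) \<in> {(x, y). x < y} \<Longrightarrow> f z = g z"
    then have eq: "\<And>z. z < s \<Longrightarrow> f z = g z" by auto
    have "combine {..<s} (\<lambda>p q. snd (f q) p) = combine {..<s} (\<lambda>p q. snd (g q) p)"
      by (simp add: combine_def fun_eq_iff eq)
    moreover have "(strand {..<s} (\<lambda>q. fst (f q)) b :: (nat \<Rightarrow> 'k) set)
        = strand {..<s} (\<lambda>q. fst (g q)) b" for b
      using eq by (auto simp: strand_def)
    ultimately show "P f s r = P g s r" by (simp add: P_def)
  next
    fix s :: nat and g :: "nat \<Rightarrow> ('v \<Rightarrow>\<^sub>0 nat) \<times> (nat \<Rightarrow> 'k)"
    assume "\<And>y. (y, s) \<in> {(x, y). x < y} \<Longrightarrow> P g y (g y)"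
    then have mem: "snd (g q) \<in> Z (fst (g q))" if "q < s" for q using that by (auto simp: P_def)
    have "combine {..<s} (\<lambda>p q. snd (g q) p) x \<in> Z b" if "x \<in> strand {..<s} (\<lambda>q. fst (g q)) b" for x b
    proof (rule submodule_family_sum[OF Z])
      fix q assume "q \<in> {..<s}" "x q \<noteq> 0"
      then have "snd (g q) \<in> Z (fst (g q))" "fst (g q) \<preceq> b"
        using that mem by (auto simp: strand_def)
      then show "(\<lambda>p. snd (g q) p) \<in> Z b" using mono by blast
    qed simp
    moreover have "\<not> generates {..<s} (\<lambda>q. fst (g q)) (\<lambda>p q. snd (g q) p) Z"
    proof
      assume "generates {..<s} (\<lambda>q. fst (g q)) (\<lambda>p q. snd (g q) p) Z"
      from nfg[OF this] mem show False by simp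
    qed
    ultimately obtain b x where "x \<in> Z b"
      "x \<notin> combine {..<s} (\<lambda>p q. snd (g q) p) ` strand {..<s} (\<lambda>q. fst (g q)) b"
      unfolding generates_def by blast
    then have "P g s (b, x)" by (simp add: P_def)
    then show "\<exists>r. P g s r" by blast
  qed
  then obtain g where "\<forall>s. P g s (g s)" ..
  then have g: "P g s (g s)" for s ..
  obtain r :: "nat \<Rightarrow> nat" where r: "strict_mono r" and le: "\<And>i j. i \<le> j \<Longrightarrow> fst (g (r i)) \<preceq> fst (g (r j))"
    using exponent_sequence_mono_subseq[of "\<lambda>i. fst (g i)"] by auto
  obtain k l where kl: "\<And>p. p < n \<Longrightarrow> snd (g (r k)) p = (\<Sum>i<k. l i * snd (g (r i)) p)"
    using linear_dependence[of n "\<lambda>i. snd (g (r i))"] by auto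
  have inj: "inj r" using r by (simp add: strict_mono_imp_inj_on)
  define x where "x q = (if q \<in> r ` {..<k} then l (inv_into UNIV r q) else 0)" for q
  have sub: "r ` {..<k} \<subseteq> {..<r k}" using r by (auto simp: strict_mono_less)
  have "x \<in> strand {..<r k} (\<lambda>q. fst (g q)) (fst (g (r k)))"
    using sub le by (auto simp: strand_def x_def)
  moreover have "snd (g (r k)) = combine {..<r k} (\<lambda>p q. snd (g q) p) x"
  proof
    fix p
    have "combine {..<r k} (\<lambda>p q. snd (g q) p) x p = (\<Sum>q\<in>r ` {..<k}. snd (g q) p * x q)"
      unfolding combine_def using sub by (intro sum.mono_neutral_right) (auto simp: x_def)
    also have "\<dots> = (\<Sum>i<k. l i * snd (g (r i)) p)"
      by (simp add: sum.reindex[OF inj_on_subset[OF inj subset_UNIV]] x_def inv_f_f[OF inj] mult.commute)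
    also have "\<dots> = snd (g (r k)) p"
    proof (cases "p < n")
      case False
      have "snd (g i) p = 0" for i
      proof -
        have "snd (g i) \<in> Z (fst (g i))" using g[of i] by (simp add: P_def)
        moreover have "Z (fst (g i)) \<subseteq> strand {..<n} a (fst (g i))"
          using Z by (simp add: submodule_family_def)
        ultimately show ?thesis using False unfolding strand_def by blast
      qed
      then show ?thesis by simp
    qed (simp add: kl)
    finally show "snd (g (r k)) p = combine {..<r k} (\<lambda>p q. snd (g q) p) x p" by simp
  qed
  ultimately have "snd (g (r k)) \<in> combine {..<r k} (\<lambda>p q. snd (g q) p) ` strand {..<r k} (\<lambda>q. fst (g q)) (fst (g (r k)))"
    by blast
  with g[of "r k"] show False by (simp add: P_def)
qed

lemma combine_drop:
  assumes "finite A" "x q = 0"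
  shows "combine (A - {q}) c x = combine A c x"
  unfolding combine_def using assms by (intro ext sum.mono_neutral_left) auto

lemma generates_reindex:
  fixes c :: "nat \<Rightarrow> nat \<Rightarrow> 'k::field"
  assumes h: "bij_betw h {..<s} A"
  shows "combine A c ` strand A d b
      = combine {..<s} (\<lambda>p q. c p (h q)) ` strand {..<s} (\<lambda>q. d (h q)) b"
proof -
  have e: "combine A c x = combine {..<s} (\<lambda>p q. c p (h q)) y"
    if "\<And>i. i < s \<Longrightarrow> y i = x (h i)" for x y
    unfolding combine_def using that by (simp flip: sum.reindex_bij_betw[OF h])
  have hA: "h i \<in> A" if "i < s" for i using bij_betwE[OF h] that by blast
  show ?thesis
  proof (intro equalityI subsetI)
    fix z assume "z \<in> combine A c ` strand A d b"
    then obtain x where x: "x \<in> strand A d b" "z = combine A c x" by blast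
    define y where "y i = (if i < s then x (h i) else 0)" for i
    have "y \<in> strand {..<s} (\<lambda>q. d (h q)) b" using x(1) by (auto simp: strand_def y_def)
    moreover have "z = combine {..<s} (\<lambda>p q. c p (h q)) y"
      unfolding x(2) by (rule e) (simp add: y_def)
    ultimately show "z \<in> combine {..<s} (\<lambda>p q. c p (h q)) ` strand {..<s} (\<lambda>q. d (h q)) b"
      by blast
  next
    fix z assume "z \<in> combine {..<s} (\<lambda>p q. c p (h q)) ` strand {..<s} (\<lambda>q. d (h q)) b"
    then obtain y where y: "y \<in> strand {..<s} (\<lambda>q. d (h q)) b"
      "z = combine {..<s} (\<lambda>p q. c p (h q)) y" by blast
    define x where "x q = (if q \<in> A then y (inv_into {..<s} h q) else 0)" for q
    have xh: "x (h i) = y i" if "i < s" for i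
      using hA[OF that] bij_betw_inv_into_left[OF h] that by (simp add: x_def)
    have "x \<in> strand A d b"
      unfolding strand_def
    proof (clarify)
      fix q assume nz: "x q \<noteq> 0"
      then have q: "q \<in> A" by (auto simp: x_def split: if_splits)
      then obtain i where "i < s" "q = h i" using h by (auto simp: bij_betw_def)
      then show "q \<in> A \<and> d q \<preceq> b" using q nz y(1) xh by (auto simp: strand_def)
    qed
    moreover have "z = combine A c x" unfolding y(2) by (rule e[symmetric]) (simp add: xh)
    ultimately show "z \<in> combine A c ` strand A d b" by blast
  qed
qed

text \<open>
  Take generators of least number. If a relation in the multidegree of a generator had a nonzero
  coefficient there, that generator would be a combination of others whose multidegrees divide its
  own, and it could be left out.
\<close>

lemma minimal_generators:
  fixes Z :: "('v::finite \<Rightarrow>\<^sub>0 nat) \<Rightarrow> (nat \<Rightarrow> 'k::field) set"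
  assumes Z: "submodule_family n a Z"
  shows "\<exists>s d c. generates {..<s} d c Z \<and> (\<forall>q<s. (\<lambda>p. c p q) \<in> Z (d q)) \<and>
    (\<forall>b. \<forall>x\<in>strand {..<s} d b. combine {..<s} c x = (\<lambda>_. 0) \<longrightarrow> (\<forall>q. x q \<noteq> 0 \<longrightarrow> d q \<noteq> b))"
proof -
  define G where "G s d c \<longleftrightarrow> generates {..<s} d c Z \<and> (\<forall>q<s. (\<lambda>p. c p q) \<in> Z (d q))"
    for s and d :: "nat \<Rightarrow> 'v \<Rightarrow>\<^sub>0 nat" and c
  have reindex: "\<exists>d' c'. G (card A) d' c'"
    if g: "generates A d c Z" and m: "\<forall>q\<in>A. (\<lambda>p. c p q) \<in> Z (d q)" for A d c
  proof -
    have "finite A" using g by (simp add: generates_def)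
    then obtain h where h: "bij_betw h {..<card A} A"
      using ex_bij_betw_nat_finite by (metis lessThan_atLeast0)
    have "generates {..<card A} (\<lambda>q. d (h q)) (\<lambda>p q. c p (h q)) Z"
      using g unfolding generates_def by (simp add: generates_reindex[OF h])
    moreover have "\<forall>q<card A. (\<lambda>p. c p (h q)) \<in> Z (d (h q))"
      using m bij_betwE[OF h] by blast
    ultimately have "G (card A) (\<lambda>q. d (h q)) (\<lambda>p q. c p (h q))" by (simp add: G_def)
    then show ?thesis by blast
  qed
  have "\<exists>s. \<exists>d c. G s d c"
  proof -
    obtain A d c where "generates A d c Z" "\<forall>q\<in>A. (\<lambda>p. c p q) \<in> Z (d q)"
      using finitely_generated[OF Z] by auto
    from reindex[OF this] show ?thesis by auto
  qed
  from exists_least_iff[THEN iffD1, OF this] obtain s d c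
    where G: "G s d c" and least: "\<And>s' d' c'. s' < s \<Longrightarrow> \<not> G s' d' c'" by auto
  have "False" if x: "x \<in> strand {..<s} d b" and rel: "combine {..<s} c x = (\<lambda>_. 0)"
    and q: "x q \<noteq> 0" and qb: "d q = b" for b x q
  proof -
    have qs: "q < s" using x q by (auto simp: strand_def)
    have "combine ({..<s} - {q}) c ` strand ({..<s} - {q}) d b' = combine {..<s} c ` strand {..<s} d b'"
      for b'
    proof (intro equalityI subsetI)
      fix z assume "z \<in> combine ({..<s} - {q}) c ` strand ({..<s} - {q}) d b'"
      then obtain y where y: "y \<in> strand ({..<s} - {q}) d b'" "z = combine ({..<s} - {q}) c y"
        by blast
      have "z = combine {..<s} c y"
        unfolding y(2) using y(1) by (intro combine_drop) (auto simp: strand_def)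
      moreover have "y \<in> strand {..<s} d b'" using y(1) by (auto simp: strand_def)
      ultimately show "z \<in> combine {..<s} c ` strand {..<s} d b'" by blast
    next
      fix z assume "z \<in> combine {..<s} c ` strand {..<s} d b'"
      then obtain y where y: "y \<in> strand {..<s} d b'" "z = combine {..<s} c y" by blast
      \<comment> \<open>a multiple of the relation \<open>x\<close> is subtracted from \<open>y\<close> so as to cancel the coefficient at \<open>q\<close>\<close>
      define y' where "y' = (\<lambda>j. y j + - (y q / x q) * x j)"
      have y'q: "y' q = 0" using q by (simp add: y'_def)
      have "combine {..<s} c y' = (\<lambda>p. combine {..<s} c y p + - (y q / x q) * combine {..<s} c x p)"
        unfolding y'_def by (rule combine_linear)
      then have "combine {..<s} c y' = z" using y(2) rel by simp
      then have "z = combine ({..<s} - {q}) c y'" using y'q by (simp add: combine_drop)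
      moreover have "y' \<in> strand ({..<s} - {q}) d b'"
        unfolding strand_def
      proof (clarify)
        fix j assume nz: "y' j \<noteq> 0"
        then have j: "j \<noteq> q" using y'q by blast
        show "j \<in> {..<s} - {q} \<and> d j \<preceq> b'"
        proof (cases "y j = 0")
          case False
          then show ?thesis using y(1) j by (auto simp: strand_def)
        next
          case True
          then have "y q \<noteq> 0" "x j \<noteq> 0" using nz by (auto simp: y'_def)
          then have "d q \<preceq> b'" "d j \<preceq> d q" "j < s" using x y(1) qb by (auto simp: strand_def)
          then show ?thesis using j mdvd_trans by blast
        qed
      qed
      ultimately show "z \<in> combine ({..<s} - {q}) c ` strand ({..<s} - {q}) d b'" by blast
    qed
    then have "generates ({..<s} - {q}) d c Z" using G by (simp add: G_def generates_def)
    moreover have "\<forall>j\<in>{..<s} - {q}. (\<lambda>p. c p j) \<in> Z (d j)" using G by (simp add: G_def)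
    ultimately obtain d' c' where "G (card ({..<s} - {q})) d' c'" using reindex by blast
    moreover have "card ({..<s} - {q}) < s" using qs by simp
    ultimately show False using least by blast
  qed
  then show ?thesis using G unfolding G_def by blast
qed

text \<open>
  A coefficient at a basis element of multidegree \<open>b\<close> in an element of multidegree \<open>b\<close> is a unit of the
  polynomial ring; the second condition forbids these, so it says that the submodule lies in the
  homogeneous maximal ideal times the free module.
\<close>

definition minimal_family ::
  "nat \<Rightarrow> (nat \<Rightarrow> 'v \<Rightarrow>\<^sub>0 nat) \<Rightarrow> (('v \<Rightarrow>\<^sub>0 nat) \<Rightarrow> (nat \<Rightarrow> 'k::field) set) \<Rightarrow> bool" where
  "minimal_family n a Z \<longleftrightarrow> submodule_family n a Z \<and> (\<forall>b. \<forall>x\<in>Z b. \<forall>p. x p \<noteq> 0 \<longrightarrow> a p \<noteq> b)"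

definition relations ::
  "nat \<Rightarrow> (nat \<Rightarrow> 'v \<Rightarrow>\<^sub>0 nat) \<Rightarrow> (nat \<Rightarrow> nat \<Rightarrow> 'k::field) \<Rightarrow> ('v \<Rightarrow>\<^sub>0 nat) \<Rightarrow> (nat \<Rightarrow> 'k) set" where
  "relations s d c b = {x \<in> strand {..<s} d b. combine {..<s} c x = (\<lambda>_. 0)}"

lemma relations_submodule: "submodule_family s d (relations s d c)"
proof -
  have "(\<lambda>p. x p + t * y p) \<in> relations s d c b"
    if x: "x \<in> relations s d c b" and y: "y \<in> relations s d c b" for b x y t
  proof -
    have "(\<lambda>p. x p + t * y p) \<in> strand {..<s} d b"
      unfolding strand_def
    proof (clarify)
      fix q assume "x q + t * y q \<noteq> 0"
      then have "x q \<noteq> 0 \<or> y q \<noteq> 0" by auto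
      then show "q \<in> {..<s} \<and> d q \<preceq> b" using x y by (auto simp: relations_def strand_def)
    qed
    moreover have "combine {..<s} c (\<lambda>p. x p + t * y p) = (\<lambda>_. 0)"
      using x y by (simp add: combine_linear relations_def)
    ultimately show ?thesis by (simp add: relations_def)
  qed
  moreover have "relations s d c b \<subseteq> relations s d c b'" if "b \<preceq> b'" for b b'
  proof -
    have "strand {..<s} d b \<subseteq> strand {..<s} d b'"
      unfolding strand_def using mdvd_trans that by blast
    then show ?thesis unfolding relations_def by blast
  qed
  moreover have "relations s d c b \<subseteq> strand {..<s} d b" for b
    by (auto simp: relations_def)
  moreover have "(\<lambda>_. 0) \<in> relations s d c b" for b
    by (simp add: relations_def strand_def)
  ultimately show ?thesis
    unfolding submodule_family_def by (intro conjI allI impI)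
qed

text \<open>
  Minimal generators of a submodule form the next matrix of the resolution, and their minimality is
  the property that the submodule of relations again satisfies.
\<close>

lemma resolution_step:
  fixes Z :: "('v::finite \<Rightarrow>\<^sub>0 nat) \<Rightarrow> (nat \<Rightarrow> 'k::field) set"
  assumes Z: "minimal_family n a Z"
  shows "\<exists>s d c. (\<forall>p q. c p q \<noteq> 0 \<longrightarrow> p < n \<and> q < s \<and> a p \<preceq> d q \<and> a p \<noteq> d q) \<and>
     (\<forall>b. combine {..<s} c ` strand {..<s} d b = Z b) \<and> minimal_family s d (relations s d c)"
proof -
  have sub: "submodule_family n a Z" using Z by (simp add: minimal_family_def)
  from minimal_generators[OF sub] obtain s d c0 where gen: "generates {..<s} d c0 Z"
    and mem: "\<forall>q<s. (\<lambda>p. c0 p q) \<in> Z (d q)"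
    and min: "\<forall>b. \<forall>x\<in>strand {..<s} d b. combine {..<s} c0 x = (\<lambda>_. 0) \<longrightarrow> (\<forall>q. x q \<noteq> 0 \<longrightarrow> d q \<noteq> b)"
    by (elim exE conjE) blast
  define c where "c p q = (if q < s then c0 p q else 0)" for p q
  have eq: "combine {..<s} c = combine {..<s} c0"
    by (simp add: combine_def c_def fun_eq_iff)
  have "p < n \<and> q < s \<and> a p \<preceq> d q \<and> a p \<noteq> d q" if nz: "c p q \<noteq> 0" for p q
  proof -
    have q: "q < s" and nz: "c0 p q \<noteq> 0" using nz by (auto simp: c_def split: if_splits)
    have "Z (d q) \<subseteq> strand {..<n} a (d q)" using sub by (simp add: submodule_family_def)
    moreover have m: "(\<lambda>p. c0 p q) \<in> Z (d q)" using mem q by blast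
    ultimately have "(\<lambda>p. c0 p q) \<in> strand {..<n} a (d q)" by blast
    then have "p < n \<and> a p \<preceq> d q" using nz by (simp add: strand_def)
    moreover have "a p \<noteq> d q"
      using Z m nz unfolding minimal_family_def by meson
    ultimately show ?thesis using q by blast
  qed
  moreover have "combine {..<s} c ` strand {..<s} d b = Z b" for b
    using gen by (simp add: generates_def eq)
  moreover have "minimal_family s d (relations s d c)"
    unfolding minimal_family_def
  proof (intro conjI allI ballI impI relations_submodule)
    fix b x q assume "x \<in> relations s d c b" and "x q \<noteq> 0"
    then show "d q \<noteq> b" using min unfolding relations_def eq by blast
  qed
  ultimately show ?thesis by blast
qed

section \<open>Resolutions of monomial ideals as matrices of scalars\<close>

text \<open>
  A multigraded free resolution of the quotient by the monomial ideal with exponent set \<open>S\<close>, written as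
  scalars: the \<open>i\<close>-th matrix has the entries \<open>c i p q\<close> times the monomial with exponent
  \<open>a (i + 1) q - a i p\<close>, and exactness is required in each multidegree separately. The zeroth module is
  the ring itself.
\<close>

definition scalar_resolution ::
  "('v \<Rightarrow>\<^sub>0 nat) set \<Rightarrow> (nat \<Rightarrow> nat) \<Rightarrow> (nat \<Rightarrow> nat \<Rightarrow> 'v \<Rightarrow>\<^sub>0 nat)
    \<Rightarrow> (nat \<Rightarrow> nat \<Rightarrow> nat \<Rightarrow> 'k::field) \<Rightarrow> bool" where
  "scalar_resolution S r a c \<longleftrightarrow>
     r 0 = 1 \<and> a 0 0 = 0 \<and>
     (\<forall>i p q. c i p q \<noteq> 0 \<longrightarrow> p < r i \<and> q < r (Suc i) \<and> a i p \<preceq> a (Suc i) q) \<and>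
     (\<forall>b. combine {..<r (Suc 0)} (c 0) ` strand {..<r (Suc 0)} (a (Suc 0)) b
        = (if b \<in> S then strand {..<1} (a 0) b else {\<lambda>_. 0})) \<and>
     (\<forall>i b. combine {..<r (Suc (Suc i))} (c (Suc i)) ` strand {..<r (Suc (Suc i))} (a (Suc (Suc i))) b
        = relations (r (Suc i)) (a (Suc i)) (c i) b)"

lemma minimal_scalar_resolution_exists:
  fixes S :: "('v::finite \<Rightarrow>\<^sub>0 nat) set"
  assumes up: "\<And>a b. a \<in> S \<Longrightarrow> a \<preceq> b \<Longrightarrow> b \<in> S" and S0: "0 \<notin> S"
  shows "\<exists>r a (c :: nat \<Rightarrow> nat \<Rightarrow> nat \<Rightarrow> 'k::field). scalar_resolution S r a c \<and>
           (\<forall>i p q. c i p q \<noteq> 0 \<longrightarrow> a i p \<noteq> a (Suc i) q)"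
proof -
  define Z0 :: "('v \<Rightarrow>\<^sub>0 nat) \<Rightarrow> (nat \<Rightarrow> 'k) set"
    where "Z0 b = (if b \<in> S then strand {..<1} (\<lambda>_. 0) b else {\<lambda>_. 0})" for b
  have Z0: "x \<in> Z0 b \<longleftrightarrow> (\<forall>q. x q \<noteq> 0 \<longrightarrow> q = 0 \<and> b \<in> S)" for x b
    by (auto simp: Z0_def strand_def fun_eq_iff)
  have Z0_sub: "submodule_family 1 (\<lambda>_. 0) Z0"
    unfolding submodule_family_def subset_iff Z0 strand_def using up
    by (auto simp: strand_def) (metis add_0 mult_zero_right)+
  have Z0_min: "minimal_family 1 (\<lambda>_. 0) Z0"
    unfolding minimal_family_def using Z0_sub Z0 S0 by auto
  define P where "P i w \<longleftrightarrow> (case w of (n, a, Z) \<Rightarrow>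
      minimal_family n a Z \<and> (i = 0 \<longrightarrow> n = 1 \<and> a = (\<lambda>_. 0) \<and> Z = Z0))"
    for i :: nat and w :: "nat \<times> (nat \<Rightarrow> 'v \<Rightarrow>\<^sub>0 nat) \<times> (('v \<Rightarrow>\<^sub>0 nat) \<Rightarrow> (nat \<Rightarrow> 'k) set)"
  define Q where "Q w w' c \<longleftrightarrow> (case (w, w') of ((n, a, Z), (s, d, Z')) \<Rightarrow>
      (\<forall>p q. c p q \<noteq> 0 \<longrightarrow> p < n \<and> q < s \<and> a p \<preceq> d q \<and> a p \<noteq> d q) \<and>
      (\<forall>b. combine {..<s} c ` strand {..<s} d b = Z b) \<and> Z' = relations s d c)"
    for w w' :: "nat \<times> (nat \<Rightarrow> 'v \<Rightarrow>\<^sub>0 nat) \<times> (('v \<Rightarrow>\<^sub>0 nat) \<Rightarrow> (nat \<Rightarrow> 'k) set)" and c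
  \<comment> \<open>a state consists of a rank, multidegrees, and the submodule that is to be covered next\<close>
  have "\<exists>w. \<forall>i. P i (w i) \<and> (\<exists>c. Q (w i) (w (Suc i)) c)"
  proof (rule dependent_nat_choice)
    show "\<exists>w. P 0 w" using Z0_min by (intro exI[of _ "(1, \<lambda>_. 0, Z0)"]) (simp add: P_def)
  next
    fix w i assume "P i w"
    then obtain n a Z where w: "w = (n, a, Z)" and Z: "minimal_family n a Z"
      by (cases w) (auto simp: P_def)
    obtain s d c where "\<forall>p q. c p q \<noteq> 0 \<longrightarrow> p < n \<and> q < s \<and> a p \<preceq> d q \<and> a p \<noteq> d q"
      "\<forall>b. combine {..<s} c ` strand {..<s} d b = Z b" "minimal_family s d (relations s d c)"
      using resolution_step[OF Z] by (elim exE conjE) blast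
    then have "P (Suc i) (s, d, relations s d c)" "Q w (s, d, relations s d c) c"
      by (simp_all add: P_def Q_def w)
    then show "\<exists>w'. P (Suc i) w' \<and> (\<exists>c. Q w w' c)" by blast
  qed
  then obtain w where w: "\<forall>i. P i (w i) \<and> (\<exists>c. Q (w i) (w (Suc i)) c)" ..
  then have "\<forall>i. \<exists>c. Q (w i) (w (Suc i)) c" by simp
  from choice[OF this] obtain c where "\<forall>i. Q (w i) (w (Suc i)) (c i)" ..
  then have Q: "Q (w i) (w (Suc i)) (c i)" for i ..
  from w have P: "P i (w i)" for i by simp
  define r where "r i = fst (w i)" for i
  define a where "a i = fst (snd (w i))" for i
  define Z where "Z i = snd (snd (w i))" for i
  have w: "w i = (r i, a i, Z i)" for i by (simp add: r_def a_def Z_def)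
  have init: "r 0 = 1" "a 0 = (\<lambda>_. 0)" "Z 0 = Z0"
    using P[of 0] by (simp_all add: P_def w)
  have c: "c i p q \<noteq> 0 \<Longrightarrow> p < r i \<and> q < r (Suc i) \<and> a i p \<preceq> a (Suc i) q \<and> a i p \<noteq> a (Suc i) q"
    and im: "combine {..<r (Suc i)} (c i) ` strand {..<r (Suc i)} (a (Suc i)) b = Z i b"
    and rel: "Z (Suc i) = relations (r (Suc i)) (a (Suc i)) (c i)" for i p q b
    using Q[of i] by (auto simp: Q_def w)
  have "combine {..<r (Suc 0)} (c 0) ` strand {..<r (Suc 0)} (a (Suc 0)) b
      = (if b \<in> S then strand {..<1} (a 0) b else {\<lambda>_. 0})" for b
    using im[of 0 b] init by (simp only: Z0_def)
  moreover have "combine {..<r (Suc (Suc i))} (c (Suc i)) ` strand {..<r (Suc (Suc i))} (a (Suc (Suc i))) b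
      = relations (r (Suc i)) (a (Suc i)) (c i) b" for i b
    using im[of "Suc i" b] rel[of i] by simp
  ultimately have "scalar_resolution S r a c"
    unfolding scalar_resolution_def using init(1,2) c by simp
  with c show ?thesis by blast
qed

text \<open>
  In multidegree \<open>b\<close> the complex with the degrees \<open>a - t\<close> is the original complex in multidegree \<open>b + t\<close>,
  because \<open>a - t\<close> divides \<open>b\<close> exactly when \<open>a\<close> divides \<open>b + t\<close>.
\<close>

lemma scalar_resolution_colon:
  assumes R: "scalar_resolution S r a c"
  shows "scalar_resolution {m. m + t \<in> S} r (\<lambda>i q. a i q - t) c"
proof -
  have strand: "strand A (\<lambda>q. d q - t) b = strand A d (b + t)" for A d b
    by (simp add: strand_def diff_mdvd_iff)
  have rel: "relations s (\<lambda>q. d q - t) c b = relations s d c (b + t)" for s d c b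
    by (simp add: relations_def strand)
  have diff: "x - t \<preceq> y - t" if "x \<preceq> y" for x y
    using that by (auto simp: mdvd_def lookup_minus intro: diff_le_mono)
  have "strand {..<1} (a 0) (b + t) = strand {..<1} (\<lambda>q. a 0 q - t) b" for b
    by (simp add: strand)
  moreover have "0 - t = 0" by (rule poly_mapping_eqI) (simp add: lookup_minus)
  ultimately show ?thesis
    using R diff by (simp add: scalar_resolution_def strand rel)
qed

definition monomial_mat ::
  "nat \<Rightarrow> nat \<Rightarrow> (nat \<Rightarrow> 'v \<Rightarrow>\<^sub>0 nat) \<Rightarrow> (nat \<Rightarrow> 'v \<Rightarrow>\<^sub>0 nat) \<Rightarrow> (nat \<Rightarrow> nat \<Rightarrow> 'k::field)
    \<Rightarrow> ('v, 'k) mpoly mat" where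
  "monomial_mat n s a d c = mat n s (\<lambda>(p, q). Poly_Mapping.single (d q - a p) (c p q))"

text \<open>
  The scalars of the part of a polynomial vector in multidegree \<open>b\<close>.
\<close>

definition component ::
  "nat \<Rightarrow> (nat \<Rightarrow> 'v \<Rightarrow>\<^sub>0 nat) \<Rightarrow> ('v \<Rightarrow>\<^sub>0 nat) \<Rightarrow> ('v, 'k::field) mpoly vec \<Rightarrow> nat \<Rightarrow> 'k" where
  "component n a b v p = (if p < n \<and> a p \<preceq> b then lookup (v $ p) (b - a p) else 0)"

lemma component_strand: "component n a b v \<in> strand {..<n} a b"
  by (simp add: strand_def component_def)

lemma component_at: "p < n \<Longrightarrow> component n a (m + a p) v p = lookup (v $ p) m"
  by (simp add: component_def)

lemma component_inject:
  assumes "v \<in> carrier_vec n" "w \<in> carrier_vec n" "\<And>b. component n a b v = component n a b w"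
  shows "v = w"
proof (rule eq_vecI)
  fix p assume "p < dim_vec w"
  then have p: "p < n" using assms by simp
  show "v $ p = w $ p"
  proof (rule poly_mapping_eqI)
    fix m
    show "lookup (v $ p) m = lookup (w $ p) m"
      using assms(3)[of "m + a p"] component_at[OF p, of a m v] component_at[OF p, of a m w] by simp
  qed
qed (use assms in simp)

text \<open>
  In each multidegree a multigraded matrix acts by its scalars.
\<close>

lemma component_mult:
  fixes c :: "nat \<Rightarrow> nat \<Rightarrow> 'k::field"
  assumes c: "\<And>p q. c p q \<noteq> 0 \<Longrightarrow> p < n \<and> a p \<preceq> d q" and w: "w \<in> carrier_vec s"
  shows "component n a b (monomial_mat n s a d c *\<^sub>v w) = combine {..<s} c (component s d b w)"
proof
  fix p
  show "component n a b (monomial_mat n s a d c *\<^sub>v w) p = combine {..<s} c (component s d b w) p"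
  proof (cases "p < n \<and> a p \<preceq> b")
    case True
    then have p: "p < n" and ab: "a p \<preceq> b" by auto
    have "lookup (Poly_Mapping.single (d q - a p) (c p q) * w $ q) (b - a p) = c p q * component s d b w q"
      if q: "q < s" for q
    proof (cases "c p q = 0")
      case False
      then have ad: "a p \<preceq> d q" using c by blast
      have "d q - a p \<preceq> b - a p \<longleftrightarrow> d q \<preceq> b"
        using diff_mdvd_iff[of "d q" "a p" "b - a p"] mdvd_add_diff[OF ab] by (simp add: add.commute)
      moreover have "b - a p - (d q - a p) = b - d q"
        using ab ad by (intro poly_mapping_eqI) (auto simp: lookup_minus mdvd_def)
      ultimately show ?thesis using q by (simp add: lookup_single_times component_def)
    qed simp
    then have "(\<Sum>q<s. lookup (Poly_Mapping.single (d q - a p) (c p q) * w $ q) (b - a p))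
        = combine {..<s} c (component s d b w) p"
      unfolding combine_def by (intro sum.cong) auto
    moreover have "(monomial_mat n s a d c *\<^sub>v w) $ p = (\<Sum>q<s. Poly_Mapping.single (d q - a p) (c p q) * w $ q)"
      using p w by (simp add: monomial_mat_def scalar_prod_def lessThan_atLeast0)
    ultimately show ?thesis using p ab by (simp add: component_def lookup_sum)
  next
    case False
    have "c p q * component s d b w q = 0" if "q < s" for q
    proof (rule ccontr)
      assume "c p q * component s d b w q \<noteq> 0"
      then have "p < n" "a p \<preceq> d q" "d q \<preceq> b" using c by (auto simp: component_def split: if_splits)
      then show False using False mdvd_trans by blast
    qed
    then have "combine {..<s} c (component s d b w) p = 0"
      unfolding combine_def by (intro sum.neutral) blast
    then show ?thesis using False by (auto simp: component_def)
  qed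
qed

lemma finite_components: "finite {b. component n a b v \<noteq> (\<lambda>_. 0)}"
proof (rule finite_subset)
  show "{b. component n a b v \<noteq> (\<lambda>_. 0)} \<subseteq> (\<Union>p<n. (\<lambda>m. m + a p) ` keys (v $ p))"
  proof
    fix b assume "b \<in> {b. component n a b v \<noteq> (\<lambda>_. 0)}"
    then obtain p where "component n a b v p \<noteq> 0" by (auto simp: fun_eq_iff)
    then have p: "p < n" "a p \<preceq> b" "b - a p \<in> keys (v $ p)"
      by (auto simp: component_def in_keys_iff split: if_splits)
    then have "b = (b - a p) + a p" using mdvd_add_diff by (metis add.commute)
    with p show "b \<in> (\<Union>p<n. (\<lambda>m. m + a p) ` keys (v $ p))" by blast
  qed
qed simp

lemma vector_of_components:
  fixes \<mu> :: "('v \<Rightarrow>\<^sub>0 nat) \<Rightarrow> nat \<Rightarrow> 'k::field"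
  assumes \<mu>: "\<And>b. \<mu> b \<in> strand {..<s} d b" and fin: "finite {b. \<mu> b \<noteq> (\<lambda>_. 0)}"
  shows "\<exists>w\<in>carrier_vec s. \<forall>b. component s d b w = \<mu> b"
proof -
  define w where "w = vec s (\<lambda>q. Abs_poly_mapping (\<lambda>m. \<mu> (m + d q) q))"
  have lookup: "lookup (w $ q) m = \<mu> (m + d q) q" if "q < s" for q m
  proof -
    have "(\<lambda>m. m + d q) ` {m. \<mu> (m + d q) q \<noteq> 0} \<subseteq> {b. \<mu> b \<noteq> (\<lambda>_. 0)}" by auto
    then have "finite ((\<lambda>m. m + d q) ` {m. \<mu> (m + d q) q \<noteq> 0})" using fin finite_subset by blast
    then have "finite {m. \<mu> (m + d q) q \<noteq> 0}" by (rule finite_imageD) (simp add: inj_on_def)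
    then show ?thesis using that by (simp add: w_def)
  qed
  have "component s d b w q = \<mu> b q" for b q
  proof (cases "q < s \<and> d q \<preceq> b")
    case True
    then have "(b - d q) + d q = b" using mdvd_add_diff by (metis add.commute)
    with True show ?thesis by (simp add: component_def lookup)
  next
    case False
    then show ?thesis using \<mu>[of b] by (auto simp: component_def strand_def)
  qed
  moreover have "w \<in> carrier_vec s" by (simp add: w_def)
  ultimately show ?thesis by blast
qed

text \<open>
  A linear system with a multigraded matrix may be solved in each multidegree separately. Taking the
  zero solution wherever the right-hand side vanishes keeps the exponents finite in number, so that the
  solutions assemble to polynomials.
\<close>

lemma monomial_mat_image_iff:
  fixes c :: "nat \<Rightarrow> nat \<Rightarrow> 'k::field"
  assumes c: "\<And>p q. c p q \<noteq> 0 \<Longrightarrow> p < n \<and> a p \<preceq> d q" and v: "v \<in> carrier_vec n"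
  shows "v \<in> (\<lambda>w. monomial_mat n s a d c *\<^sub>v w) ` carrier_vec s \<longleftrightarrow>
    (\<forall>b. component n a b v \<in> combine {..<s} c ` strand {..<s} d b)"
proof
  assume "v \<in> (\<lambda>w. monomial_mat n s a d c *\<^sub>v w) ` carrier_vec s"
  then obtain w where w: "w \<in> carrier_vec s" "v = monomial_mat n s a d c *\<^sub>v w" by blast
  show "\<forall>b. component n a b v \<in> combine {..<s} c ` strand {..<s} d b"
  proof
    fix b
    have "component n a b v = combine {..<s} c (component s d b w)"
      unfolding w(2) using c w(1) by (rule component_mult)
    then show "component n a b v \<in> combine {..<s} c ` strand {..<s} d b"
      using component_strand by blast
  qed
next
  assume *: "\<forall>b. component n a b v \<in> combine {..<s} c ` strand {..<s} d b"
  have "\<exists>x. x \<in> strand {..<s} d b \<and> component n a b v = combine {..<s} c x \<and>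
          (component n a b v = (\<lambda>_. 0) \<longrightarrow> x = (\<lambda>_. 0))" for b
  proof (cases "component n a b v = (\<lambda>_. 0)")
    case True
    then show ?thesis by (intro exI[of _ "\<lambda>_. 0"]) (simp add: strand_def)
  next
    case False
    then show ?thesis using * by blast
  qed
  then have "\<forall>b. \<exists>x. x \<in> strand {..<s} d b \<and> component n a b v = combine {..<s} c x \<and>
          (component n a b v = (\<lambda>_. 0) \<longrightarrow> x = (\<lambda>_. 0))" by simp
  from choice[OF this] obtain \<mu> where
    "\<forall>b. \<mu> b \<in> strand {..<s} d b \<and> component n a b v = combine {..<s} c (\<mu> b) \<and>
          (component n a b v = (\<lambda>_. 0) \<longrightarrow> \<mu> b = (\<lambda>_. 0))" ..
  then have \<mu>: "\<mu> b \<in> strand {..<s} d b" "component n a b v = combine {..<s} c (\<mu> b)"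
    "\<mu> b \<noteq> (\<lambda>_. 0) \<Longrightarrow> component n a b v \<noteq> (\<lambda>_. 0)" for b
    by auto
  have "finite {b. \<mu> b \<noteq> (\<lambda>_. 0)}"
    by (rule finite_subset[OF _ finite_components[of n a v]]) (use \<mu>(3) in blast)
  with \<mu>(1) obtain w where w: "w \<in> carrier_vec s" "\<And>b. component s d b w = \<mu> b"
    using vector_of_components[of \<mu> s d] by auto
  have "v = monomial_mat n s a d c *\<^sub>v w"
  proof (rule component_inject[OF v])
    show "monomial_mat n s a d c *\<^sub>v w \<in> carrier_vec n"
      by (rule carrier_vecI) (simp add: monomial_mat_def)
    fix b
    have "component n a b (monomial_mat n s a d c *\<^sub>v w) = combine {..<s} c (component s d b w)"
      using c w(1) by (rule component_mult)
    also have "\<dots> = component n a b v" by (simp only: w(2) \<mu>(2))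
    finally show "component n a b v = component n a b (monomial_mat n s a d c *\<^sub>v w)" by (rule sym)
  qed
  with w(1) show "v \<in> (\<lambda>w. monomial_mat n s a d c *\<^sub>v w) ` carrier_vec s" by blast
qed

lemma monomial_mat_kernel_iff:
  fixes c :: "nat \<Rightarrow> nat \<Rightarrow> 'k::field"
  assumes c: "\<And>p q. c p q \<noteq> 0 \<Longrightarrow> p < n \<and> a p \<preceq> d q" and w: "w \<in> carrier_vec s"
  shows "monomial_mat n s a d c *\<^sub>v w = 0\<^sub>v n \<longleftrightarrow> (\<forall>b. component s d b w \<in> relations s d c b)"
proof -
  have Mw: "monomial_mat n s a d c *\<^sub>v w \<in> carrier_vec n"
    by (rule carrier_vecI) (simp add: monomial_mat_def)
  have z: "component n a b (0\<^sub>v n) = (\<lambda>_. 0)" for b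
    by (simp add: component_def fun_eq_iff)
  have "monomial_mat n s a d c *\<^sub>v w = 0\<^sub>v n
      \<longleftrightarrow> (\<forall>b. component n a b (monomial_mat n s a d c *\<^sub>v w) = component n a b (0\<^sub>v n))"
    using component_inject[OF Mw, of "0\<^sub>v n"] by auto
  then show ?thesis
    by (simp only: component_mult[where c=c and a=a and d=d, OF c w] z relations_def mem_Collect_eq component_strand simp_thms)
qed

definition monomial_ideal :: "('v \<Rightarrow>\<^sub>0 nat) set \<Rightarrow> ('v, 'k::field) mpoly set" where
  "monomial_ideal S = {f. keys f \<subseteq> S}"

definition up_closed :: "('v \<Rightarrow>\<^sub>0 nat) set \<Rightarrow> bool" where
  "up_closed S \<longleftrightarrow> (\<forall>a b. a \<in> S \<longrightarrow> a \<preceq> b \<longrightarrow> b \<in> S)"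

lemma monomial_ideal_ring_ideal:
  fixes S :: "('v \<Rightarrow>\<^sub>0 nat) set"
  assumes "up_closed S"
  shows "ring_ideal (monomial_ideal S :: ('v, 'k::field) mpoly set)"
proof -
  have "r * f \<in> monomial_ideal S" if f: "f \<in> monomial_ideal S" for r f :: "('v, 'k) mpoly"
    unfolding monomial_ideal_def
  proof (clarify)
    fix m assume "m \<in> keys (r * f)"
    then obtain u v where "m = u + v" "v \<in> keys f" using keys_mult[of r f] by blast
    then show "m \<in> S" using f assms mdvd_add(2) unfolding monomial_ideal_def up_closed_def by blast
  qed
  moreover have "f + g \<in> monomial_ideal S" if "f \<in> monomial_ideal S" "g \<in> monomial_ideal S"
    for f g :: "('v, 'k) mpoly"
    using that keys_add[of f g] by (auto simp: monomial_ideal_def)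
  ultimately show ?thesis by (auto simp: ring_ideal_def monomial_ideal_def)
qed

lemma monomial_ideal_graded: "graded_set (monomial_ideal S)"
  using keys_graded_part unfolding graded_set_def monomial_ideal_def by blast

definition resolution_of_scalars ::
  "(nat \<Rightarrow> nat) \<Rightarrow> (nat \<Rightarrow> nat \<Rightarrow> 'v \<Rightarrow>\<^sub>0 nat) \<Rightarrow> (nat \<Rightarrow> nat \<Rightarrow> nat \<Rightarrow> 'k::field)
    \<Rightarrow> ('v, 'k) mpoly free_complex" where
  "resolution_of_scalars r a c =
     \<lparr>rank = r, shift = (\<lambda>i q. int (monom_deg (a i q))), aug = vec 1 (\<lambda>_. 1),
      diff = (\<lambda>i. monomial_mat (r i) (r (Suc i)) (a i) (a (Suc i)) (c i))\<rparr>"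

lemma scalar_resolution_graded:
  fixes a :: "nat \<Rightarrow> nat \<Rightarrow> 'v::finite \<Rightarrow>\<^sub>0 nat" and c :: "nat \<Rightarrow> nat \<Rightarrow> nat \<Rightarrow> 'k::field"
  assumes R: "scalar_resolution S r a c"
  shows "graded_free_resolution (monomial_ideal S) (resolution_of_scalars r a c)"
proof -
  let ?D = "\<lambda>i. monomial_mat (r i) (r (Suc i)) (a i) (a (Suc i)) (c i)"
  have r0: "r 0 = 1" and a0: "a 0 0 = 0"
    and c: "\<And>i p q. c i p q \<noteq> 0 \<Longrightarrow> p < r i \<and> a i p \<preceq> a (Suc i) q"
    and im0: "\<And>b. combine {..<r (Suc 0)} (c 0) ` strand {..<r (Suc 0)} (a (Suc 0)) b
        = (if b \<in> S then strand {..<1} (a 0) b else {\<lambda>_. 0})"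
    and im: "\<And>i b. combine {..<r (Suc (Suc i))} (c (Suc i)) ` strand {..<r (Suc (Suc i))} (a (Suc (Suc i))) b
        = relations (r (Suc i)) (a (Suc i)) (c i) b"
    using R by (simp_all add: scalar_resolution_def)
  have hom: "homogeneous (int (monom_deg (a (Suc i) q)) - int (monom_deg (a i p))) (?D i $$ (p, q))"
    if "p < r i" "q < r (Suc i)" for i p q
  proof (cases "c i p q = 0")
    case True
    then show ?thesis using that by (simp add: monomial_mat_def homogeneous_def)
  next
    case False
    then have "a i p + (a (Suc i) q - a i p) = a (Suc i) q" using c mdvd_add_diff by blast
    then have "monom_deg (a (Suc i) q) = monom_deg (a i p) + monom_deg (a (Suc i) q - a i p)"
      by (metis monom_deg_add)
    then show ?thesis using that False by (simp add: monomial_mat_def homogeneous_def)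
  qed
  have aug_apply: "vec 1 (\<lambda>_. 1) \<bullet> v = v $ 0" if "v \<in> carrier_vec 1" for v :: "('v, 'k) mpoly vec"
    using that by (simp add: scalar_prod_def)
  have aug0: "vec 1 (\<lambda>_. 1) \<bullet> v \<in> monomial_ideal S \<longleftrightarrow> v \<in> (\<lambda>w. ?D 0 *\<^sub>v w) ` carrier_vec (r 1)"
    if v: "v \<in> carrier_vec (r 0)" for v
  proof -
    have comp: "component (r 0) (a 0) b v q = (if q = 0 then lookup (v $ 0) b else 0)" for b q
      by (simp add: component_def r0 a0)
    have "v \<in> (\<lambda>w. ?D 0 *\<^sub>v w) ` carrier_vec (r 1)
        \<longleftrightarrow> (\<forall>b. component (r 0) (a 0) b v \<in> (if b \<in> S then strand {..<1} (a 0) b else {\<lambda>_. 0}))"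
      using monomial_mat_image_iff[where c="c 0" and a="a 0" and d="a (Suc 0)", OF c v] im0 by simp
    also have "\<dots> \<longleftrightarrow> (\<forall>b. b \<notin> S \<longrightarrow> lookup (v $ 0) b = 0)"
    proof (intro all_cong1)
      fix b
      show "component (r 0) (a 0) b v \<in> (if b \<in> S then strand {..<1} (a 0) b else {\<lambda>_. 0})
          \<longleftrightarrow> (b \<notin> S \<longrightarrow> lookup (v $ 0) b = 0)"
      proof (cases "b \<in> S")
        case True
        then show ?thesis using component_strand[of "r 0" "a 0" b v] by (simp add: r0)
      next
        case False
        then show ?thesis by (auto simp: comp fun_eq_iff)
      qed
    qed
    also have "\<dots> \<longleftrightarrow> v $ 0 \<in> monomial_ideal S"
      by (auto simp: monomial_ideal_def in_keys_iff)
    finally show ?thesis using aug_apply v r0 by metis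
  qed
  have surj: "\<exists>v\<in>carrier_vec (r 0). f - vec 1 (\<lambda>_. 1) \<bullet> v \<in> monomial_ideal S" for f :: "('v, 'k) mpoly"
    by (rule bexI[of _ "vec 1 (\<lambda>_. f)"]) (simp_all add: scalar_prod_def monomial_ideal_def r0)
  have ker: "?D i *\<^sub>v v = 0\<^sub>v (r i) \<longleftrightarrow> v \<in> (\<lambda>w. ?D (Suc i) *\<^sub>v w) ` carrier_vec (r (Suc (Suc i)))"
    if v: "v \<in> carrier_vec (r (Suc i))" for i v
    using monomial_mat_kernel_iff[where c="c i" and a="a i" and d="a (Suc i)", OF c v] monomial_mat_image_iff[where c="c (Suc i)" and a="a (Suc i)" and d="a (Suc (Suc i))", OF c v] im
    by simp
  have carr: "?D i \<in> carrier_mat (r i) (r (Suc i))" for i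
    by (simp add: monomial_mat_def)
  have h0: "homogeneous (int (monom_deg (a 0 q))) (vec 1 (\<lambda>_. 1) $ q :: ('v, 'k) mpoly)"
    if "q < r 0" for q
    using that by (simp add: r0 a0 homogeneous_def)
  have "vec 1 (\<lambda>_. 1) \<in> carrier_vec (r 0)" by (simp add: r0)
  with hom aug0 surj ker carr h0 show ?thesis
    unfolding graded_free_resolution_def resolution_of_scalars_def free_complex.simps by simp
qed

lemma scalar_resolution_minimal:
  fixes a :: "nat \<Rightarrow> nat \<Rightarrow> 'v::finite \<Rightarrow>\<^sub>0 nat" and c :: "nat \<Rightarrow> nat \<Rightarrow> nat \<Rightarrow> 'k::field"
  assumes R: "scalar_resolution S r a c" and min: "\<And>i p q. c i p q \<noteq> 0 \<Longrightarrow> a i p \<noteq> a (Suc i) q"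
  shows "minimal_graded_free_resolution (monomial_ideal S) (resolution_of_scalars r a c)"
proof -
  have "lookup (monomial_mat (r i) (r (Suc i)) (a i) (a (Suc i)) (c i) $$ (p, q)) 0 = 0"
    if "p < r i" "q < r (Suc i)" for i p q
  proof (cases "c i p q = 0")
    case True
    then show ?thesis using that by (simp add: monomial_mat_def)
  next
    case False
    then have "a i p \<preceq> a (Suc i) q" using R by (simp add: scalar_resolution_def)
    then have "a (Suc i) q - a i p \<noteq> 0" using mdvd_add_diff min[OF False] by (metis add.right_neutral)
    then show ?thesis using that by (simp add: monomial_mat_def lookup_single)
  qed
  with scalar_resolution_graded[OF R] show ?thesis
    unfolding minimal_graded_free_resolution_def by (simp add: resolution_of_scalars_def)
qed

text \<open>
  The scalars of a minimal resolution for \<open>S\<close> also resolve the quotient by the colon ideal, with smaller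
  degrees. Comparing with a minimal resolution of the latter bounds each of its degrees, at the same
  homological position, by a degree that occurs for \<open>S\<close>. The assumption \<open>t \<notin> S\<close> says that the colon ideal
  is proper, so that its minimal resolution starts with the ring.
\<close>

theorem regularity_colon_monomial:
  fixes S :: "('v::finite \<Rightarrow>\<^sub>0 nat) set"
  assumes up: "up_closed S" and t: "t \<notin> S"
  shows "regularity_quotient (monomial_ideal {m. m + t \<in> S} :: ('v, 'k::field) mpoly set)
      \<le> regularity_quotient (monomial_ideal S :: ('v, 'k) mpoly set)"
proof -
  let ?T = "{m. m + t \<in> S}"
  have "0 \<notin> S" using up t zero_mdvd unfolding up_closed_def by blast
  then obtain r a and c :: "nat \<Rightarrow> nat \<Rightarrow> nat \<Rightarrow> 'k" where R: "scalar_resolution S r a c"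
    and min: "\<And>i p q. c i p q \<noteq> 0 \<Longrightarrow> a i p \<noteq> a (Suc i) q"
    using minimal_scalar_resolution_exists[of S] up unfolding up_closed_def by auto
  have upT: "up_closed ?T"
    unfolding up_closed_def
  proof (clarify)
    fix x y assume "x + t \<in> S" "x \<preceq> y"
    moreover have "x + t \<preceq> y + t" using \<open>x \<preceq> y\<close> by (simp add: mdvd_def lookup_add)
    ultimately show "y + t \<in> S" using up unfolding up_closed_def by blast
  qed
  have "0 \<notin> ?T" using t by simp
  then obtain r' a' and c' :: "nat \<Rightarrow> nat \<Rightarrow> nat \<Rightarrow> 'k" where R': "scalar_resolution ?T r' a' c'"
    and min': "\<And>i p q. c' i p q \<noteq> 0 \<Longrightarrow> a' i p \<noteq> a' (Suc i) q"
    using minimal_scalar_resolution_exists[of ?T] upT unfolding up_closed_def by auto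
  have M: "minimal_graded_free_resolution (monomial_ideal S) (resolution_of_scalars r a c)"
    using R min by (rule scalar_resolution_minimal)
  have M': "minimal_graded_free_resolution (monomial_ideal ?T) (resolution_of_scalars r' a' c')"
    using R' min' by (rule scalar_resolution_minimal)
  note F = scalar_resolution_graded[OF scalar_resolution_colon[OF R, of t]]
  have betti: "\<exists>j'\<ge>j. graded_betti (monomial_ideal S :: ('v, 'k) mpoly set) i j' \<noteq> 0"
    if nz: "graded_betti (monomial_ideal ?T :: ('v, 'k) mpoly set) i j \<noteq> 0" for i j
  proof -
    obtain q where "q < rank (resolution_of_scalars r' a' c') i"
      and q: "shift (resolution_of_scalars r' a' c') i q = j"
      using nz graded_betti_nonzero_iff[OF monomial_ideal_ring_ideal[OF upT] monomial_ideal_graded M', of i j]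
      by blast
    from minimal_shift_occurs[OF monomial_ideal_ring_ideal[OF upT] monomial_ideal_graded M' F this(1)] q
    obtain p where p: "p < r i" "int (monom_deg (a i p - t)) = j"
      by (auto simp: resolution_of_scalars_def)
    have "graded_betti (monomial_ideal S :: ('v, 'k) mpoly set) i (int (monom_deg (a i p))) \<noteq> 0"
      using p(1) graded_betti_nonzero_iff[OF monomial_ideal_ring_ideal[OF up] monomial_ideal_graded M]
      by (auto simp: resolution_of_scalars_def)
    moreover have "j \<le> int (monom_deg (a i p))" using p(2) monom_deg_diff_le[of "a i p" t] by simp
    ultimately show ?thesis by blast
  qed
  show ?thesis
    unfolding regularity_quotient_def
  proof (rule Sup_mono)
    fix x assume "x \<in> {ereal (real_of_int (j - int i)) | i j.
      graded_betti (monomial_ideal ?T :: ('v, 'k) mpoly set) i j \<noteq> 0}"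
    then obtain i j where x: "x = ereal (real_of_int (j - int i))"
      and "graded_betti (monomial_ideal ?T :: ('v, 'k) mpoly set) i j \<noteq> 0" by blast
    then obtain j' where "j \<le> j'" and b: "graded_betti (monomial_ideal S :: ('v, 'k) mpoly set) i j' \<noteq> 0"
      using betti by blast
    then have "x \<le> ereal (real_of_int (j' - int i))" by (simp add: x)
    with b show "\<exists>y\<in>{ereal (real_of_int (j - int i)) | i j.
      graded_betti (monomial_ideal S :: ('v, 'k) mpoly set) i j \<noteq> 0}. x \<le> y" by blast
  qed
qed

section \<open>Matchings and vertex covers\<close>

text \<open>
  Hall's marriage theorem by Rado's argument. If some \<open>N x\<close> contains two elements \<open>a\<close> and \<open>b\<close>, one of
  them can be deleted without destroying Hall's condition: violations \<open>W\<close> and \<open>Y\<close> for the two deletions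
  would contradict the condition for \<open>W \<union> Y \<union> {x}\<close> and \<open>W \<inter> Y\<close>, by counting. Once all the sets are
  singletons, the condition for pairs says that they are distinct.
\<close>

lemma hall:
  fixes N :: "'a \<Rightarrow> 'b set"
  assumes "finite S" and "\<And>x. x \<in> S \<Longrightarrow> finite (N x)"
    and "\<And>W. W \<subseteq> S \<Longrightarrow> card W \<le> card (\<Union>(N ` W))"
  shows "\<exists>f. inj_on f S \<and> (\<forall>x\<in>S. f x \<in> N x)"
  using assms(2,3)
proof (induction "\<Sum>x\<in>S. card (N x)" arbitrary: N rule: less_induct)
  case less
  note fin = less.prems(1) and hall = less.prems(2)
  show ?case
  proof (cases "\<forall>x\<in>S. card (N x) = 1")
    case True
    define f where "f x = the_elem (N x)" for x
    have N: "N x = {f x}" if "x \<in> S" for x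
      using True that unfolding f_def by (metis card_1_singletonE the_elem_eq)
    have "inj_on f S"
    proof (rule inj_onI, rule ccontr)
      fix x y assume xy: "x \<in> S" "y \<in> S" "f x = f y" "x \<noteq> y"
      then have "card {x, y} \<le> card (\<Union>(N ` {x, y}))" by (intro hall) auto
      then show False using xy by (simp add: N)
    qed
    with N show ?thesis by auto
  next
    case False
    then obtain x where x: "x \<in> S" "card (N x) \<noteq> 1" by blast
    have "card {x} \<le> card (\<Union>(N ` {x}))" using x by (intro hall) auto
    then have c2: "2 \<le> card (N x)" using x by simp
    then obtain a where a: "a \<in> N x" by fastforce
    have "1 \<le> card (N x - {a})" using c2 a fin[OF x(1)] by simp
    then obtain b where b: "b \<in> N x" "b \<noteq> a"
      by (metis DiffE card.empty insertCI not_one_le_zero subset_empty subsetI)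
    define N' where "N' d = N(x := N x - {d})" for d
    show ?thesis
    proof (cases "\<exists>d\<in>{a, b}. \<forall>W\<subseteq>S. card W \<le> card (\<Union>(N' d ` W))")
      case True
      then obtain d where d: "d \<in> N x" and h: "\<And>W. W \<subseteq> S \<Longrightarrow> card W \<le> card (\<Union>(N' d ` W))"
        using a b by blast
      have "card (N x - {d}) < card (N x)" using fin[OF x(1)] d by (rule card_Diff1_less)
      then have "(\<Sum>y\<in>S. card (N' d y)) < (\<Sum>y\<in>S. card (N y))"
        using assms(1) x(1) by (intro sum_strict_mono_ex1) (auto simp: N'_def)
      moreover have "finite (N' d y)" if "y \<in> S" for y
        using fin[OF that] fin[OF x(1)] by (simp add: N'_def)
      ultimately obtain f where "inj_on f S" "\<forall>y\<in>S. f y \<in> N' d y"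
        using less.hyps[of "N' d"] h by blast
      moreover have "N' d y \<subseteq> N y" for y by (auto simp: N'_def)
      ultimately show ?thesis by blast
    next
      case False
      have ex: "\<exists>W\<subseteq>S - {x}. card (\<Union>(N ` W) \<union> (N x - {d})) \<le> card W" if d: "d \<in> {a, b}" for d
      proof -
        obtain Y where Y: "Y \<subseteq> S" "card (\<Union>(N' d ` Y)) < card Y"
          using False d by (meson not_le)
        have "x \<in> Y"
        proof (rule ccontr)
          assume "x \<notin> Y"
          then have "\<Union>(N' d ` Y) = \<Union>(N ` Y)" by (auto simp: N'_def)
          with hall[OF Y(1)] Y(2) show False by simp
        qed
        then have "\<Union>(N' d ` Y) = \<Union>(N ` (Y - {x})) \<union> (N x - {d})"
          by (auto simp: N'_def)
        moreover have "card (Y - {x}) = card Y - 1" using \<open>x \<in> Y\<close> by simp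
        ultimately have "card (\<Union>(N ` (Y - {x})) \<union> (N x - {d})) \<le> card (Y - {x})"
          using Y(2) by simp
        moreover have "Y - {x} \<subseteq> S - {x}" using Y(1) by blast
        ultimately show ?thesis by blast
      qed
      obtain W where W: "W \<subseteq> S - {x}" "card (\<Union>(N ` W) \<union> (N x - {a})) \<le> card W"
        using ex[of a] by blast
      obtain Y where Y: "Y \<subseteq> S - {x}" "card (\<Union>(N ` Y) \<union> (N x - {b})) \<le> card Y"
        using ex[of b] by blast
      have fX: "finite W" "finite Y" using W(1) Y(1) assms(1) finite_subset by blast+
      have fN: "finite (\<Union>(N ` Z))" if "Z \<subseteq> S" for Z
        using that assms(1) fin finite_subset by blast
      let ?A = "\<Union>(N ` W) \<union> (N x - {a})" and ?B = "\<Union>(N ` Y) \<union> (N x - {b})"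
      have fin_AB: "finite ?A" "finite ?B"
        using fN[of W] fN[of Y] fin[OF x(1)] W(1) Y(1) by auto
      have "card (W \<union> Y) + 1 = card (insert x (W \<union> Y))"
        using W(1) Y(1) fX by (subst card_insert_disjoint) auto
      also have "\<dots> \<le> card (\<Union>(N ` insert x (W \<union> Y)))"
        using W(1) Y(1) x(1) by (intro hall) auto
      also have "\<Union>(N ` insert x (W \<union> Y)) = ?A \<union> ?B" using b by auto
      finally have 1: "card (W \<union> Y) + 1 \<le> card (?A \<union> ?B)" .
      have "card (W \<inter> Y) \<le> card (\<Union>(N ` (W \<inter> Y)))" using W(1) by (intro hall) auto
      also have "\<dots> \<le> card (?A \<inter> ?B)" using fin_AB by (intro card_mono) auto
      finally have "card (W \<union> Y) + 1 + card (W \<inter> Y) \<le> card (?A \<union> ?B) + card (?A \<inter> ?B)"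
        using 1 by simp
      then have "card W + card Y + 1 \<le> card ?A + card ?B"
        using card_Un_Int[OF fin_AB] card_Un_Int[OF fX] by simp
      with W(2) Y(2) show ?thesis by simp
    qed
  qed
qed

definition independent :: "'v::finite set set \<Rightarrow> 'v set \<Rightarrow> bool" where
  "independent E S \<longleftrightarrow> (\<forall>e\<in>E. \<not> e \<subseteq> S)"

definition neighbours :: "'v::finite set set \<Rightarrow> 'v set \<Rightarrow> 'v set" where
  "neighbours E S = {u. \<exists>v\<in>S. {u, v} \<in> E}"

lemma minimal_cover_below:
  assumes "vertex_cover E W"
  shows "\<exists>C\<subseteq>W. minimal_vertex_cover E C"
  using finite[of W] assms
proof (induction W rule: finite_psubset_induct)
  case (psubset W)
  show ?case
  proof (cases "\<exists>D. D \<subset> W \<and> vertex_cover E D")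
    case True
    then show ?thesis using psubset.IH by (meson order.trans psubset_imp_subset)
  next
    case False
    then show ?thesis using psubset.prems unfolding minimal_vertex_cover_def by blast
  qed
qed

lemma independent_iff_cover: "independent E S \<longleftrightarrow> vertex_cover E (- S)"
  unfolding independent_def vertex_cover_def by blast

lemma independentD:
  assumes "independent E S" "{u, v} \<in> E" "u \<in> S"
  shows "v \<notin> S"
proof
  assume "v \<in> S"
  with assms(3) have "{u, v} \<subseteq> S" by simp
  with assms(1,2) show False unfolding independent_def by blast
qed

lemma independent_subset: "independent E S \<Longrightarrow> T \<subseteq> S \<Longrightarrow> independent E T"
  unfolding independent_def by (meson subset_trans)

lemma neighbours_disjoint: "independent E S \<Longrightarrow> T \<subseteq> S \<Longrightarrow> neighbours E T \<inter> S = {}"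
  unfolding neighbours_def using independentD by fastforce

lemma edge_cases:
  assumes "simple_graph E" "e \<in> E"
  obtains u v where "e = {u, v}" "u \<noteq> v"
  using assms unfolding simple_graph_def by (meson card_2_iff)

lemma card_independent_le:
  assumes "unmixed E" "minimal_vertex_cover E C" "independent E T"
  shows "card T \<le> card (- C)"
proof -
  obtain D where D: "D \<subseteq> - T" "minimal_vertex_cover E D"
    using assms(3) minimal_cover_below independent_iff_cover by metis
  have "card T \<le> card (- D)" using D(1) by (intro card_mono) auto
  also have "\<dots> = card (- C)"
  proof -
    have "card C = card D" using assms D(2) unfolding unmixed_def by blast
    then show ?thesis by (simp add: Compl_eq_Diff_UNIV card_Diff_subset)
  qed
  finally show ?thesis .
qed

text \<open>
  For \<open>s \<in> S\<close> choose a neighbour \<open>y\<close> and an independent set \<open>T\<close> of maximal size through \<open>y\<close>. Replacing in \<open>T\<close>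
  the neighbours of \<open>S\<close> by \<open>S\<close> gives an independent set, which cannot be larger; so \<open>S - T\<close> has at most as
  many elements as \<open>T\<close> has neighbours of \<open>S\<close>. The set \<open>S \<inter> T\<close> misses \<open>s\<close>, and its neighbours lie outside
  \<open>T\<close>, so that the induction hypothesis accounts for the rest.
\<close>

lemma card_independent_le_neighbours:
  assumes simple: "simple_graph E" and un: "unmixed E" and iso: "\<forall>v. \<exists>e\<in>E. v \<in> e"
    and "independent E S"
  shows "card S \<le> card (neighbours E S)"
  using finite[of S] assms(4)
proof (induction S rule: finite_psubset_induct)
  case (psubset S)
  show ?case
  proof (cases "S = {}")
    case False
    then obtain s where s: "s \<in> S" by blast
    obtain y where y: "{s, y} \<in> E" "s \<noteq> y"
    proof -
      obtain e where e: "e \<in> E" "s \<in> e" using iso by blast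
      obtain u v where uv: "e = {u, v}" "u \<noteq> v" by (rule edge_cases[OF simple e(1)])
      have "s = u \<or> s = v" using e(2) uv(1) by blast
      then show thesis using that[of v] that[of u] e(1) uv by (auto simp: insert_commute)
    qed
    have "independent E {y}"
      unfolding independent_def
    proof (intro ballI notI)
      fix e assume "e \<in> E" "e \<subseteq> {y}"
      then have "card e = 2" using simple unfolding simple_graph_def by blast
      moreover have "card e \<le> card {y}" using \<open>e \<subseteq> {y}\<close> by (intro card_mono) auto
      ultimately show False by simp
    qed
    then obtain C where C: "C \<subseteq> - {y}" "minimal_vertex_cover E C"
      using minimal_cover_below[of E "- {y}"] independent_iff_cover[of E "{y}"] by blast
    define T where "T = - C"
    have T: "independent E T" using C(2) by (simp add: independent_iff_cover T_def minimal_vertex_cover_def)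
    have yT: "y \<in> T" using C(1) by (auto simp: T_def)
    let ?N = "neighbours E S"
    have SN: "?N \<inter> S = {}" by (rule neighbours_disjoint[OF psubset.prems subset_refl])
    have "independent E ((T - ?N) \<union> S)"
      unfolding independent_def
    proof (intro ballI notI)
      fix e assume e: "e \<in> E" "e \<subseteq> (T - ?N) \<union> S"
      obtain u v where uv: "e = {u, v}" by (rule edge_cases[OF simple e(1)])
      have nT: "\<not> e \<subseteq> T" and nS: "\<not> e \<subseteq> S"
        using e(1) T psubset.prems unfolding independent_def by auto
      have half: False if "{u, v} \<in> E" "{u, v} \<subseteq> (T - ?N) \<union> S" "\<not> {u, v} \<subseteq> T" "u \<notin> S" for u v
      proof -
        have "u \<in> T" "u \<notin> ?N" "v \<in> S" using that by auto
        then show False using that(1) unfolding neighbours_def by blast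
      qed
      have "u \<notin> S \<or> v \<notin> S" using nS uv by blast
      then show False
        using half[of u v] half[of v u] e nT unfolding uv by (auto simp: insert_commute)
    qed
    then have "card ((T - ?N) \<union> S) \<le> card T"
      using card_independent_le[OF un C(2)] by (simp add: T_def)
    moreover have "(T - ?N) \<union> S = (T - ?N) \<union> (S - T)" using SN by blast
    moreover have "card ((T - ?N) \<union> (S - T)) = card (T - ?N) + card (S - T)"
      by (rule card_Un_disjoint) auto
    moreover have "card T = card (T - ?N) + card (T \<inter> ?N)"
      by (simp add: card_Diff_subset_Int card_mono)
    ultimately have 1: "card (S - T) \<le> card (T \<inter> ?N)" by simp
    have "s \<notin> T" using independentD[OF T y(1)] yT by blast
    then have "S \<inter> T \<subset> S" using s by blast
    moreover have "independent E (S \<inter> T)"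
      by (rule independent_subset[OF psubset.prems]) simp
    ultimately have "card (S \<inter> T) \<le> card (neighbours E (S \<inter> T))" by (rule psubset.IH)
    also have "neighbours E (S \<inter> T) \<subseteq> ?N - T"
      using neighbours_disjoint[OF T, of "S \<inter> T"] by (auto simp: neighbours_def)
    then have "card (neighbours E (S \<inter> T)) \<le> card (?N - T)" by (intro card_mono) auto
    finally have "card (S - T) + card (S \<inter> T) \<le> card (T \<inter> ?N) + card (?N - T)" using 1 by simp
    moreover have "card S = card (S - T) + card (S \<inter> T)"
      by (simp add: card_Diff_subset_Int card_mono)
    moreover have "card ?N = card (T \<inter> ?N) + card (?N - T)"
      by (simp add: card_Diff_subset_Int card_mono Int_commute)
    ultimately show ?thesis by simp
  qed simp
qed

text \<open>
  The matching supplied by Hall's theorem is perfect, since a minimal cover fills at most half of the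
  vertices. All minimal covers have as many elements as the matching has edges and meet each of its
  edges, which leaves one vertex for each; hence any edge of the matching will do.
\<close>

lemma edge_met_once:
  fixes E :: "'v::finite set set"
  assumes simple: "simple_graph E" and un: "unmixed E" and iso: "\<forall>v. \<exists>e\<in>E. v \<in> e"
    and half: "\<And>C. minimal_vertex_cover E C \<Longrightarrow> 2 * card C \<le> card (UNIV :: 'v set)"
  shows "\<exists>x y. x \<noteq> y \<and> {x, y} \<in> E \<and> (\<forall>D. minimal_vertex_cover E D \<longrightarrow> card (D \<inter> {x, y}) = 1)"
proof -
  have "vertex_cover E UNIV"
    unfolding vertex_cover_def
  proof
    fix e assume "e \<in> E"
    then have "card e = 2" using simple unfolding simple_graph_def by blast
    then show "e \<inter> UNIV \<noteq> {}" by auto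
  qed
  then obtain C where C: "minimal_vertex_cover E C" using minimal_cover_below by blast
  define S where "S = - C"
  have S: "independent E S" using C by (simp add: independent_iff_cover S_def minimal_vertex_cover_def)
  have UN: "card (UNIV :: 'v set) = card S + card C"
    by (simp add: S_def Compl_eq_Diff_UNIV card_Diff_subset card_mono)
  have nb_ind: "card W \<le> card (neighbours E W)" if "W \<subseteq> S" for W
  proof -
    have "independent E W" using S that by (rule independent_subset)
    then show ?thesis using card_independent_le_neighbours[OF simple un iso] by blast
  qed
  have SC: "neighbours E S \<subseteq> C"
    using neighbours_disjoint[OF S subset_refl] by (auto simp: S_def)
  have "card S \<le> card C" using nb_ind[of S] card_mono[OF _ SC] by simp
  then have eq: "card S = card C" using half[OF C] UN by simp
  have union: "\<Union>((\<lambda>v. neighbours E {v}) ` W) = neighbours E W" for W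
    unfolding neighbours_def by blast
  have "card W \<le> card (\<Union>((\<lambda>v. neighbours E {v}) ` W))" if "W \<subseteq> S" for W
    unfolding union by (rule nb_ind[OF that])
  then have "\<exists>f. inj_on f S \<and> (\<forall>v\<in>S. f v \<in> neighbours E {v})"
    by (intro hall) simp_all
  then obtain f where f: "inj_on f S" and fN: "\<forall>v\<in>S. f v \<in> neighbours E {v}" by blast
  have edge: "{v, f v} \<in> E" if "v \<in> S" for v
  proof -
    have "f v \<in> neighbours E {v}" using fN that by blast
    then show ?thesis by (simp add: neighbours_def insert_commute)
  qed
  have fC: "f ` S \<subseteq> C"
  proof
    fix u assume "u \<in> f ` S"
    then obtain v where "v \<in> S" "u = f v" by blast
    then show "u \<in> C" using independentD[OF S edge] by (auto simp: S_def)
  qed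
  have im: "f ` S = C"
    using fC eq f by (intro card_subset_eq) (auto simp: card_image)
  have neq: "v \<noteq> f v" if "v \<in> S" for v using that fC by (auto simp: S_def)
  have disj: "{v, f v} \<inter> {w, f w} = {}" if "v \<in> S" "w \<in> S" "v \<noteq> w" for v w
    using that fC f by (auto simp: S_def inj_on_def)
  have "S \<noteq> {}"
  proof
    assume "S = {}"
    then have "card (UNIV :: 'v set) = 0" using UN eq by simp
    then show False by simp
  qed
  then obtain x where x: "x \<in> S" by blast
  have "card (D \<inter> {x, f x}) = 1" if D: "minimal_vertex_cover E D" for D
  proof -
    have meet: "1 \<le> card (D \<inter> {v, f v})" if "v \<in> S" for v
    proof -
      have "D \<inter> {v, f v} \<noteq> {}"
        using D edge[OF that] unfolding minimal_vertex_cover_def vertex_cover_def by blast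
      then have "0 < card (D \<inter> {v, f v})" by (simp add: card_gt_0_iff)
      then show ?thesis by simp
    qed
    have "D = (\<Union>v\<in>S. D \<inter> {v, f v})" using im by (auto simp: S_def)
    then have "card D = card (\<Union>v\<in>S. D \<inter> {v, f v})" by simp
    also have "\<dots> = (\<Sum>v\<in>S. card (D \<inter> {v, f v}))"
      using disj by (intro card_UN_disjoint) auto
    also have "\<dots> = card (D \<inter> {x, f x}) + (\<Sum>v\<in>S - {x}. card (D \<inter> {v, f v}))"
      using x by (simp add: sum.remove)
    finally have "card D = card (D \<inter> {x, f x}) + (\<Sum>v\<in>S - {x}. card (D \<inter> {v, f v}))" .
    moreover have "(\<Sum>v\<in>S - {x}. 1) \<le> (\<Sum>v\<in>S - {x}. card (D \<inter> {v, f v}))"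
      using meet by (intro sum_mono) auto
    moreover have "card D = card S"
    proof -
      have "card D = card C" using un C D unfolding unmixed_def by blast
      then show ?thesis using eq by simp
    qed
    moreover have "card S = 1 + card (S - {x})"
      using card_Suc_Diff1[OF _ x] by simp
    ultimately show ?thesis using meet[OF x] by simp
  qed
  with edge[OF x] neq[OF x] show ?thesis by blast
qed

section \<open>Prime ideals generated by variables\<close>

lemma ring_of_type_sel [simp]:
  "carrier ring_of_type_algebra = UNIV"
  "x \<otimes>\<^bsub>ring_of_type_algebra\<^esub> y = x * y"
  "x \<oplus>\<^bsub>ring_of_type_algebra\<^esub> y = x + y"
  "\<one>\<^bsub>ring_of_type_algebra\<^esub> = 1"
  "\<zero>\<^bsub>ring_of_type_algebra\<^esub> = 0"
  by (simp_all add: ring_of_type_algebra_def)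

lemma ideal_iff_ring_ideal:
  fixes I :: "'r::comm_ring_1 set"
  shows "ideal I ring_of_type_algebra \<longleftrightarrow> ring_ideal I"
proof
  assume id: "ideal I ring_of_type_algebra"
  then interpret ideal I "ring_of_type_algebra :: 'r ring" .
  have "0 \<in> I" using additive_subgroup.zero_closed[OF ideal.axioms(1)[OF id]] by simp
  moreover have "a + b \<in> I" if "a \<in> I" "b \<in> I" for a b
    using additive_subgroup.a_closed[OF ideal.axioms(1)[OF id] that] by simp
  moreover have "r * a \<in> I" if "a \<in> I" for a r
    using I_l_closed[OF that, of r] by simp
  ultimately show "ring_ideal I" unfolding ring_ideal_def by blast
next
  assume I: "ring_ideal I"
  have neg: "- x \<in> I" if "x \<in> I" for x using ring_ideal_mult[OF I that, of "- 1"] by simp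
  show "ideal I ring_of_type_algebra"
  proof (rule idealI)
    show "subgroup I (add_monoid ring_of_type_algebra)"
    proof (rule group.subgroupI)
      show "Group.group (add_monoid (ring_of_type_algebra :: 'r ring))"
        using ring_from_type_algebra by (rule ring.is_abelian_group[THEN abelian_group.a_group])
      show "I \<noteq> {}" using ring_ideal_zero[OF I] by blast
    next
      fix x assume x: "x \<in> I"
      have "inv\<^bsub>add_monoid ring_of_type_algebra\<^esub> x = - x"
      proof -
        interpret ring "ring_of_type_algebra :: 'r ring" by (rule ring_from_type_algebra)
        have "\<ominus>\<^bsub>ring_of_type_algebra\<^esub> x = - x"
          by (rule minus_equality) simp_all
        then show ?thesis by (simp add: a_inv_def)
      qed
      then show "inv\<^bsub>add_monoid ring_of_type_algebra\<^esub> x \<in> I" using neg[OF x] by simp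
    qed (use ring_ideal_add[OF I] in simp_all)
  qed (use ring_from_type_algebra ring_ideal_mult[OF I] in \<open>simp_all add: mult.commute\<close>)
qed

lemma primeideal_iff:
  fixes P :: "'r::comm_ring_1 set"
  shows "primeideal P ring_of_type_algebra \<longleftrightarrow>
    ring_ideal P \<and> 1 \<notin> P \<and> (\<forall>a b. a * b \<in> P \<longrightarrow> a \<in> P \<or> b \<in> P)"
proof
  assume "primeideal P ring_of_type_algebra"
  then interpret primeideal P "ring_of_type_algebra :: 'r ring" .
  have P: "ring_ideal P" using is_ideal by (simp add: ideal_iff_ring_ideal)
  have "1 \<notin> P"
  proof
    assume "1 \<in> P"
    then have "x \<in> P" for x using ring_ideal_mult[OF P, of 1 x] by simp
    then show False using I_notcarr by auto
  qed
  then show "ring_ideal P \<and> 1 \<notin> P \<and> (\<forall>a b. a * b \<in> P \<longrightarrow> a \<in> P \<or> b \<in> P)"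
    using P I_prime by simp
next
  assume P: "ring_ideal P \<and> 1 \<notin> P \<and> (\<forall>a b. a * b \<in> P \<longrightarrow> a \<in> P \<or> b \<in> P)"
  show "primeideal P ring_of_type_algebra"
  proof (rule primeidealI)
    show "ideal P ring_of_type_algebra" using P by (simp add: ideal_iff_ring_ideal)
    show "cring (ring_of_type_algebra :: 'r ring)" by (rule cring_from_type_algebra)
    show "carrier ring_of_type_algebra \<noteq> P" using P by auto
  qed (use P in simp)
qed

lemma prime_prod:
  fixes P :: "'r::comm_ring_1 set"
  assumes P: "primeideal P ring_of_type_algebra" and "finite A" and "prod f A \<in> P"
  shows "\<exists>x\<in>A. f x \<in> P"
  using assms(2,3)
proof (induction A rule: finite_induct)
  case empty
  then show ?case using P by (simp add: primeideal_iff)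
next
  case (insert x A)
  then have "f x * prod f A \<in> P" by simp
  then have "f x \<in> P \<or> prod f A \<in> P" using P unfolding primeideal_iff by blast
  then show ?case using insert.IH by blast
qed

text \<open>
  The monomials of order at least \<open>k\<close> along the prime generated by the variables in \<open>C\<close>; they span its
  \<open>k\<close>-th power.
\<close>

definition order_above :: "'v set \<Rightarrow> nat \<Rightarrow> ('v \<Rightarrow>\<^sub>0 nat) set" where
  "order_above C k = {m. k \<le> (\<Sum>v\<in>C. lookup m v)}"

lemma order_above_up_closed: "up_closed (order_above C k)"
  unfolding up_closed_def order_above_def mdvd_def
  by (auto intro: order_trans[OF _ sum_mono])

lemma order_above_add:
  "a \<in> order_above C k \<Longrightarrow> b \<in> order_above C l \<Longrightarrow> a + b \<in> order_above C (k + l)"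
  by (simp add: order_above_def lookup_add sum.distrib)

lemma order_above_1: "m \<in> order_above C 1 \<longleftrightarrow> (\<exists>v\<in>C. 1 \<le> lookup m v)" for C :: "'v::finite set"
proof -
  have "(\<Sum>v\<in>C. lookup m v) = 0 \<longleftrightarrow> (\<forall>v\<in>C. lookup m v = 0)" by (rule sum_eq_0_iff) simp
  moreover have "m \<in> order_above C 1 \<longleftrightarrow> (\<Sum>v\<in>C. lookup m v) \<noteq> 0"
    by (simp add: order_above_def Suc_le_eq del: sum_eq_0_iff)
  moreover have "1 \<le> lookup m v \<longleftrightarrow> lookup m v \<noteq> 0" for v by (simp add: Suc_le_eq)
  ultimately show ?thesis by blast
qed

definition cover_prime :: "'v set \<Rightarrow> ('v, 'k::field) mpoly set" where
  "cover_prime C = monomial_ideal (order_above C 1)"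

text \<open>
  Enumerating the variables embeds the exponent vectors additively into the finitely supported
  functions on the natural numbers, which carry a compatible linear order. This is a monomial order,
  used below to single out leading monomials.
\<close>

lemma monomial_order_exists:
  "\<exists>\<omega> :: ('v::finite \<Rightarrow>\<^sub>0 nat) \<Rightarrow> (nat \<Rightarrow>\<^sub>0 nat). inj \<omega> \<and> (\<forall>a b. \<omega> (a + b) = \<omega> a + \<omega> b)"
proof -
  obtain \<phi> :: "'v \<Rightarrow> nat" where \<phi>: "inj \<phi>"
    using finite_imp_inj_to_nat_seg[of "UNIV :: 'v set"] by auto
  define \<omega> :: "('v \<Rightarrow>\<^sub>0 nat) \<Rightarrow> (nat \<Rightarrow>\<^sub>0 nat)"
    where "\<omega> m = (\<Sum>v\<in>UNIV. Poly_Mapping.single (\<phi> v) (lookup m v))" for m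
  have "lookup (\<omega> m) (\<phi> v) = lookup m v" for m v
    using \<phi> by (simp add: \<omega>_def lookup_sum lookup_single when_def inj_eq)
  then have "inj \<omega>" by (intro injI poly_mapping_eqI) metis
  moreover have "\<omega> (a + b) = \<omega> a + \<omega> b" for a b
    by (simp add: \<omega>_def lookup_add single_add sum.distrib)
  ultimately show ?thesis by blast
qed

text \<open>
  Discard from \<open>f\<close> and \<open>g\<close> the monomials that lie in the ideal. The leading monomials of what remains
  multiply to a monomial outside the ideal, which can arise in \<open>f * g\<close> in no other way and so survives.
\<close>

lemma cover_prime_prime:
  fixes C :: "'v::finite set"
  shows "primeideal (cover_prime C :: ('v, 'k::field) mpoly set) ring_of_type_algebra"
proof -
  have "f * g \<notin> cover_prime C" if f: "f \<notin> cover_prime C" and g: "g \<notin> cover_prime C"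
    for f g :: "('v, 'k) mpoly"
  proof -
    obtain \<omega> :: "('v \<Rightarrow>\<^sub>0 nat) \<Rightarrow> (nat \<Rightarrow>\<^sub>0 nat)"
      where inj: "inj \<omega>" and add: "\<forall>a b. \<omega> (a + b) = \<omega> a + \<omega> b"
      using monomial_order_exists by blast
    let ?off = "\<lambda>h. keys h - order_above C 1"
    have ne: "?off f \<noteq> {}" "?off g \<noteq> {}"
      using f g by (auto simp: cover_prime_def monomial_ideal_def)
    have max: "\<exists>a\<in>A. \<forall>l\<in>A. \<omega> l \<le> \<omega> a" if "finite A" "A \<noteq> {}" for A
    proof -
      have "Max (\<omega> ` A) \<in> \<omega> ` A" using that by (intro Max_in) auto
      then obtain a where a: "a \<in> A" "\<omega> a = Max (\<omega> ` A)" by auto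
      have "\<omega> l \<le> \<omega> a" if "l \<in> A" for l
        unfolding a(2) using that \<open>finite A\<close> by (intro Max_ge) auto
      with a(1) show ?thesis by blast
    qed
    obtain a where a: "a \<in> ?off f" "\<forall>l\<in>?off f. \<omega> l \<le> \<omega> a"
      using max[OF _ ne(1)] by auto
    obtain b where b: "b \<in> ?off g" "\<forall>l\<in>?off g. \<omega> l \<le> \<omega> b"
      using max[OF _ ne(2)] by auto
    have off: "(\<Sum>v\<in>C. lookup m v) = 0 \<longleftrightarrow> m \<notin> order_above C 1" for m
      by (auto simp: order_above_def Suc_le_eq)
    have sum0: "(\<Sum>v\<in>C. lookup (a + b) v) = 0"
      using a(1) b(1) off[of a] off[of b] by (simp add: lookup_add sum.distrib)
    have "lookup f l * (if l \<preceq> a + b then lookup g (a + b - l) else 0) = (if l = a then lookup f a * lookup g b else 0)"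
      if l: "l \<in> keys f" for l
    proof (cases "l \<preceq> a + b \<and> lookup g (a + b - l) \<noteq> 0")
      case True
      let ?r = "a + b - l"
      have s: "l + ?r = a + b" using True mdvd_add_diff by blast
      have "(\<Sum>v\<in>C. lookup (l + ?r) v) = 0" unfolding s by (rule sum0)
      then have "(\<Sum>v\<in>C. lookup l v) + (\<Sum>v\<in>C. lookup ?r v) = 0"
        by (simp only: lookup_add sum.distrib)
      then have "l \<in> ?off f" "?r \<in> ?off g" using off l True by (auto simp: in_keys_iff)
      then have le: "\<omega> l \<le> \<omega> a" "\<omega> ?r \<le> \<omega> b" using a(2) b(2) by blast+
      have eq: "\<omega> l + \<omega> ?r = \<omega> a + \<omega> b"
        unfolding add[rule_format, symmetric] s ..
      have "\<omega> l = \<omega> a"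
      proof (rule ccontr)
        assume "\<omega> l \<noteq> \<omega> a"
        then have "\<omega> l < \<omega> a" using le(1) by simp
        then have "\<omega> l + \<omega> ?r < \<omega> a + \<omega> b" using le(2) by (rule add_less_le_mono)
        then show False using eq by simp
      qed
      then have "l = a" using inj by (simp add: inj_eq)
      then show ?thesis by simp
    next
      case False
      have "l \<noteq> a \<or> lookup g b = 0" using False by auto
      with False show ?thesis by auto
    qed
    then have "lookup (f * g) (a + b) = (\<Sum>l\<in>keys f. if l = a then lookup f a * lookup g b else 0)"
      unfolding lookup_times by (intro sum.cong) auto
    also have "\<dots> = lookup f a * lookup g b" using a(1) by simp
    also have "\<dots> \<noteq> 0" using a(1) b(1) by (simp add: in_keys_iff)
    finally have "a + b \<in> keys (f * g)" by (simp add: in_keys_iff)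
    moreover have "a + b \<notin> order_above C 1" using sum0 off by blast
    ultimately show ?thesis by (auto simp: cover_prime_def monomial_ideal_def)
  qed
  moreover have "ring_ideal (cover_prime C :: ('v, 'k) mpoly set)"
    unfolding cover_prime_def by (rule monomial_ideal_ring_ideal[OF order_above_up_closed])
  moreover have "1 \<notin> (cover_prime C :: ('v, 'k) mpoly set)"
    by (auto simp: cover_prime_def monomial_ideal_def order_above_def)
  ultimately show ?thesis unfolding primeideal_iff by blast
qed

lemma monomial_ideal_subset_ideal:
  assumes I: "ring_ideal I"
    and gen: "\<And>m. m \<in> S \<Longrightarrow> \<exists>s. s \<preceq> m \<and> Poly_Mapping.single s 1 \<in> I"
  shows "monomial_ideal S \<subseteq> (I :: ('v, 'k::field) mpoly set)"
proof
  fix f :: "('v, 'k) mpoly" assume f: "f \<in> monomial_ideal S"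
  have "(\<Sum>m\<in>keys f. Poly_Mapping.single m (lookup f m)) \<in> I"
  proof (rule ring_ideal_sum[OF I])
    fix m assume "m \<in> keys f"
    then have "m \<in> S" using f by (auto simp: monomial_ideal_def)
    then obtain s where s: "s \<preceq> m" "Poly_Mapping.single s 1 \<in> I" using gen by blast
    have "Poly_Mapping.single m (lookup f m) = Poly_Mapping.single (m - s) (lookup f m) * Poly_Mapping.single s 1"
      using mdvd_add_diff[OF s(1)] by (simp add: mult_single add.commute)
    then show "Poly_Mapping.single m (lookup f m) \<in> I" using ring_ideal_mult[OF I s(2)] by simp
  qed
  then show "f \<in> I" by (simp add: sum_single_keys)
qed

text \<open>
  A monomial of order at least \<open>k + 1\<close> along \<open>C\<close> is divisible by a variable in \<open>C\<close>; splitting it off leaves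
  order at least \<open>k\<close>.
\<close>

lemma cover_prime_power:
  fixes C :: "'v::finite set"
  shows "(cover_prime C :: ('v, 'k::field) mpoly set) [^]\<^bsub>ideals_set ring_of_type_algebra\<^esub> k
    = monomial_ideal (order_above C k)"
proof (induction k)
  case 0
  show ?case by (simp add: nat_pow_def ideals_set_def monomial_ideal_def order_above_def)
next
  case (Suc k)
  let ?R = "ring_of_type_algebra :: ('v, 'k) mpoly ring"
  let ?J = "monomial_ideal (order_above C k) :: ('v, 'k) mpoly set"
  let ?P = "cover_prime C :: ('v, 'k) mpoly set"
  have id: "ideal ?J ?R" "ideal ?P ?R"
    unfolding cover_prime_def ideal_iff_ring_ideal
    by (rule monomial_ideal_ring_ideal[OF order_above_up_closed])+
  have "?P [^]\<^bsub>ideals_set ?R\<^esub> Suc k = ideal_prod ?R ?J ?P"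
    using Suc by (simp add: nat_pow_def ideals_set_def)
  also have "\<dots> = monomial_ideal (order_above C (Suc k))"
  proof
    show "ideal_prod ?R ?J ?P \<subseteq> monomial_ideal (order_above C (Suc k))"
    proof
      fix f assume "f \<in> ideal_prod ?R ?J ?P"
      then show "f \<in> monomial_ideal (order_above C (Suc k))"
      proof (induction rule: ideal_prod.induct)
        case (prod g h)
        show ?case
          unfolding monomial_ideal_def
        proof (clarify)
          fix m assume "m \<in> keys (g \<otimes>\<^bsub>?R\<^esub> h)"
          then have "m \<in> keys (g * h)" by simp
          then obtain a b where m: "m = a + b" "a \<in> keys g" "b \<in> keys h" using keys_mult[of g h] by blast
          have "a \<in> order_above C k" "b \<in> order_above C 1"
            using prod m by (auto simp: monomial_ideal_def cover_prime_def)
          then show "m \<in> order_above C (Suc k)" using order_above_add[of a C k b 1] m(1) by simp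
        qed
      next
        case (sum g h)
        then show ?case using keys_add[of g h] by (auto simp: monomial_ideal_def)
      qed
    qed
    show "monomial_ideal (order_above C (Suc k)) \<subseteq> ideal_prod ?R ?J ?P"
    proof (rule monomial_ideal_subset_ideal)
      show "ring_ideal (ideal_prod ?R ?J ?P)"
        using ring.ideal_prod_is_ideal[OF ring_from_type_algebra id] by (simp add: ideal_iff_ring_ideal)
    next
      fix m assume m: "m \<in> order_above C (Suc k)"
      then have "m \<in> order_above C 1" by (simp add: order_above_def)
      then obtain v where v: "v \<in> C" "1 \<le> lookup m v" using order_above_1 by blast
      let ?e = "Poly_Mapping.single v 1 :: 'v \<Rightarrow>\<^sub>0 nat"
      have ve: "?e \<preceq> m" using v(2) by (simp add: mdvd_def lookup_single when_def)
      have se: "(\<Sum>u\<in>C. lookup ?e u) = 1" using v(1) by (simp add: lookup_single when_def)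
      have eu: "lookup ?e u + lookup (m - ?e) u = lookup m u" for u
        using arg_cong[OF mdvd_add_diff[OF ve], of "\<lambda>x. lookup x u"] unfolding lookup_add .
      have sp: "(\<Sum>u\<in>C. lookup ?e u) + (\<Sum>u\<in>C. lookup (m - ?e) u) = (\<Sum>u\<in>C. lookup m u)"
        unfolding sum.distrib[symmetric] eu ..
      have "m - ?e \<in> order_above C k" using m se sp by (simp add: order_above_def)
      then have "Poly_Mapping.single (m - ?e) 1 \<in> ?J" by (simp add: monomial_ideal_def)
      moreover have "Poly_Mapping.single ?e 1 \<in> ?P"
        using se by (simp add: cover_prime_def monomial_ideal_def order_above_def)
      ultimately have "Poly_Mapping.single (m - ?e) 1 \<otimes>\<^bsub>?R\<^esub> Poly_Mapping.single ?e 1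
          \<in> ideal_prod ?R ?J ?P" by (rule ideal_prod.prod)
      then have "Poly_Mapping.single m 1 \<in> ideal_prod ?R ?J ?P"
        using mdvd_add_diff[OF ve] by (simp add: mult_single add.commute)
      then show "\<exists>s. s \<preceq> m \<and> Poly_Mapping.single s 1 \<in> ideal_prod ?R ?J ?P"
        using mdvd_refl by blast
    qed
  qed
  finally show ?case .
qed

section \<open>Associated primes and height of the edge ideal\<close>

lemma var_times_var:
  "(var u * var v :: ('v, 'k::field) mpoly)
    = Poly_Mapping.single (Poly_Mapping.single u 1 + Poly_Mapping.single v 1) 1"
  by (simp add: var_def mult_single)

lemma edge_ideal_monomial:
  fixes E :: "'v::finite set set"
  assumes simple: "simple_graph E"
  shows "(edge_ideal E :: ('v, 'k::field) mpoly set) = monomial_ideal {m. \<exists>e\<in>E. \<forall>v\<in>e. 1 \<le> lookup m v}"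
proof
  let ?S = "{m. \<exists>e\<in>E. \<forall>v\<in>e. 1 \<le> lookup m v}"
  let ?G = "{var u * var v | u v. {u, v} \<in> E} :: ('v, 'k) mpoly set"
  have edge: "\<exists>u v. e = {u, v} \<and> u \<noteq> v" if "e \<in> E" for e
    using edge_cases[OF simple that] by blast
  have up: "up_closed ?S"
    unfolding up_closed_def mdvd_def by (auto intro: order_trans)
  have "?G \<subseteq> monomial_ideal ?S"
  proof
    fix g :: "('v, 'k) mpoly" assume "g \<in> ?G"
    then obtain u v where g: "g = var u * var v" "{u, v} \<in> E" by blast
    have "keys g = {Poly_Mapping.single u 1 + Poly_Mapping.single v 1}"
      unfolding g(1) var_times_var by simp
    moreover have "(Poly_Mapping.single u 1 + Poly_Mapping.single v 1 :: 'v \<Rightarrow>\<^sub>0 nat) \<in> ?S"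
      by (intro CollectI bexI[OF _ g(2)]) (simp add: lookup_add)
    ultimately show "g \<in> monomial_ideal ?S"
      unfolding monomial_ideal_def by (intro CollectI) (simp only: insert_subset empty_subsetI simp_thms)
  qed
  then show "edge_ideal E \<subseteq> (monomial_ideal ?S :: ('v, 'k) mpoly set)"
    unfolding edge_ideal_def genideal_def
    using monomial_ideal_ring_ideal[OF up] ideal_iff_ring_ideal by blast
  show "(monomial_ideal ?S :: ('v, 'k) mpoly set) \<subseteq> edge_ideal E"
    unfolding edge_ideal_def genideal_def
  proof (rule Inter_greatest)
    fix I :: "('v, 'k) mpoly set"
    assume "I \<in> {I. ideal I ring_of_type_algebra \<and> ?G \<subseteq> I}"
    then have I: "ring_ideal I" and G: "?G \<subseteq> I" by (auto simp: ideal_iff_ring_ideal)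
    show "monomial_ideal ?S \<subseteq> I"
    proof (rule monomial_ideal_subset_ideal[OF I])
      fix m :: "'v \<Rightarrow>\<^sub>0 nat" assume "m \<in> ?S"
      then obtain e where e: "e \<in> E" "\<And>v. v \<in> e \<Longrightarrow> 1 \<le> lookup m v" by blast
      obtain u v where uv: "e = {u, v}" "u \<noteq> v" using edge[OF e(1)] by blast
      have "Poly_Mapping.single u 1 + Poly_Mapping.single v 1 \<preceq> m"
        unfolding mdvd_def
      proof
        fix w
        show "lookup (Poly_Mapping.single u 1 + Poly_Mapping.single v 1) w \<le> lookup m w"
          using e(2)[of w] uv by (auto simp: lookup_add lookup_single when_def)
      qed
      moreover have "var u * var v \<in> I" using G e(1) uv(1) by blast
      ultimately show "\<exists>s. s \<preceq> m \<and> Poly_Mapping.single s 1 \<in> I"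
        unfolding var_times_var by blast
    qed
  qed
qed

text \<open>
  If a monomial is divisible by no edge, the vertices outside its support cover all edges, and a minimal
  cover among them gives a prime that does not contain the monomial.
\<close>

lemma edge_ideal_Inter_covers:
  fixes E :: "'v::finite set set"
  assumes simple: "simple_graph E"
  shows "f \<in> (edge_ideal E :: ('v, 'k::field) mpoly set) \<longleftrightarrow>
    (\<forall>C. minimal_vertex_cover E C \<longrightarrow> f \<in> cover_prime C)"
proof -
  have key: "(\<exists>e\<in>E. \<forall>v\<in>e. 1 \<le> lookup m v) \<longleftrightarrow> (\<forall>C. minimal_vertex_cover E C \<longrightarrow> m \<in> order_above C 1)"
    for m :: "'v \<Rightarrow>\<^sub>0 nat"
  proof
    assume "\<exists>e\<in>E. \<forall>v\<in>e. 1 \<le> lookup m v"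
    then obtain e where e: "e \<in> E" "\<forall>v\<in>e. 1 \<le> lookup m v" by blast
    show "\<forall>C. minimal_vertex_cover E C \<longrightarrow> m \<in> order_above C 1"
    proof (intro allI impI)
      fix C assume "minimal_vertex_cover E C"
      then have "e \<inter> C \<noteq> {}" using e(1) by (simp add: minimal_vertex_cover_def vertex_cover_def)
      then show "m \<in> order_above C 1" unfolding order_above_1 using e(2) by blast
    qed
  next
    assume *: "\<forall>C. minimal_vertex_cover E C \<longrightarrow> m \<in> order_above C 1"
    show "\<exists>e\<in>E. \<forall>v\<in>e. 1 \<le> lookup m v"
    proof (rule ccontr)
      assume no: "\<not> (\<exists>e\<in>E. \<forall>v\<in>e. 1 \<le> lookup m v)"
      have "vertex_cover E {v. lookup m v = 0}"
        unfolding vertex_cover_def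
      proof
        fix e assume "e \<in> E"
        then obtain v where "v \<in> e" "\<not> 1 \<le> lookup m v" using no by blast
        then have "v \<in> e \<inter> {v. lookup m v = 0}" by simp
        then show "e \<inter> {v. lookup m v = 0} \<noteq> {}" by blast
      qed
      then obtain C where C: "C \<subseteq> {v. lookup m v = 0}" "minimal_vertex_cover E C"
        using minimal_cover_below by blast
      then have "m \<in> order_above C 1" using * by blast
      then obtain v where "v \<in> C" "1 \<le> lookup m v" unfolding order_above_1 by blast
      then show False using C(1) by auto
    qed
  qed
  show ?thesis
    unfolding edge_ideal_monomial[OF simple] cover_prime_def monomial_ideal_def subset_iff
      mem_Collect_eq key
    by blast
qed

text \<open>
  Let the prime be \<open>I : f\<close>. As \<open>I\<close> is an intersection of cover primes, \<open>I : f\<close> is the intersection of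
  those that do not contain \<open>f\<close>, and a prime that is a finite intersection of ideals equals one of
  them.
\<close>

lemma associated_prime_is_cover_prime:
  fixes E :: "'v::finite set set"
  assumes simple: "simple_graph E"
    and P: "P \<in> associated_primes ring_of_type_algebra (edge_ideal E :: ('v, 'k::field) mpoly set)"
  shows "\<exists>C. minimal_vertex_cover E C \<and> P = cover_prime C"
proof (rule ccontr)
  assume no: "\<not> ?thesis"
  have prime: "primeideal P ring_of_type_algebra"
    using P by (simp add: associated_primes_def)
  obtain f where f: "P = {r. r * f \<in> edge_ideal E}"
    using P by (auto simp: associated_primes_def)
  define \<C> where "\<C> = {C. minimal_vertex_cover E C \<and> f \<notin> cover_prime C}"
  have P_iff: "r \<in> P \<longleftrightarrow> (\<forall>C\<in>\<C>. r \<in> cover_prime C)" for r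
  proof -
    have "r * f \<in> cover_prime C \<longleftrightarrow> r \<in> cover_prime C \<or> f \<in> cover_prime C" for C
    proof -
      have "primeideal (cover_prime C :: ('v, 'k) mpoly set) ring_of_type_algebra"
        by (rule cover_prime_prime)
      then have id: "ring_ideal (cover_prime C :: ('v, 'k) mpoly set)"
        and pr: "r * f \<in> cover_prime C \<Longrightarrow> r \<in> cover_prime C \<or> f \<in> cover_prime C"
        unfolding primeideal_iff by blast+
      show ?thesis
        using pr ring_ideal_mult[OF id, of r f] ring_ideal_mult[OF id, of f r]
        by (auto simp: mult.commute)
    qed
    then show ?thesis
      unfolding f mem_Collect_eq edge_ideal_Inter_covers[OF simple] \<C>_def by blast
  qed
  have "\<forall>C\<in>\<C>. \<exists>r. r \<in> cover_prime C \<and> r \<notin> P"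
  proof
    fix C assume C: "C \<in> \<C>"
    then have "P \<noteq> cover_prime C" using no by (auto simp: \<C>_def)
    moreover have "P \<subseteq> cover_prime C" using P_iff C by blast
    ultimately show "\<exists>r. r \<in> cover_prime C \<and> r \<notin> P" by blast
  qed
  from bchoice[OF this] obtain r
    where r: "\<And>C. C \<in> \<C> \<Longrightarrow> r C \<in> cover_prime C" "\<And>C. C \<in> \<C> \<Longrightarrow> r C \<notin> P" by blast
  have "prod r \<C> \<in> P"
    unfolding P_iff
  proof
    fix C assume C: "C \<in> \<C>"
    have id: "ring_ideal (cover_prime C :: ('v, 'k) mpoly set)"
      unfolding cover_prime_def by (rule monomial_ideal_ring_ideal[OF order_above_up_closed])
    have "prod r \<C> = prod r (\<C> - {C}) * r C"
      using C by (simp add: prod.remove mult.commute)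
    then show "prod r \<C> \<in> cover_prime C" using ring_ideal_mult[OF id r(1)[OF C]] by simp
  qed
  then obtain C where "C \<in> \<C>" "r C \<in> P" using prime_prod[OF prime] by (metis finite)
  then show False using r(2) by blast
qed

text \<open>
  A prime over the edge ideal contains a variable from each edge, hence all the variables of some
  minimal cover. Adding these variables one at a time gives a chain of primes below it.
\<close>

lemma height_ge_cover:
  fixes E :: "'v::finite set set"
  assumes simple: "simple_graph E" and card: "\<And>C. minimal_vertex_cover E C \<Longrightarrow> card C = n"
  shows "enat n \<le> ideal_height ring_of_type_algebra (edge_ideal E :: ('v, 'k::field) mpoly set)"
  unfolding ideal_height_def
proof (rule INF_greatest)
  let ?R = "ring_of_type_algebra :: ('v, 'k) mpoly ring"
  fix P assume "P \<in> {P. primeideal P ?R \<and> edge_ideal E \<subseteq> P}"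
  then have P: "primeideal P ?R" and IP: "edge_ideal E \<subseteq> P" by auto
  have idP: "ring_ideal P" using P unfolding primeideal_iff by blast
  have "vertex_cover E {v. var v \<in> P}"
    unfolding vertex_cover_def
  proof
    fix e assume e: "e \<in> E"
    obtain u v where uv: "e = {u, v}" by (rule edge_cases[OF simple e])
    have "var u * var v \<in> (edge_ideal E :: ('v, 'k) mpoly set)"
      unfolding edge_ideal_def genideal_def using e uv by blast
    then have "var u * var v \<in> P" using IP by blast
    then have "var u \<in> P \<or> var v \<in> P" using P unfolding primeideal_iff by blast
    then show "e \<inter> {v. var v \<in> P} \<noteq> {}" using uv by auto
  qed
  then obtain C where C: "C \<subseteq> {v. var v \<in> P}" "minimal_vertex_cover E C"
    using minimal_cover_below by blast
  have subP: "cover_prime D \<subseteq> P" if D: "D \<subseteq> C" for D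
    unfolding cover_prime_def
  proof (rule monomial_ideal_subset_ideal[OF idP])
    fix m assume "m \<in> order_above D 1"
    then obtain v where v: "v \<in> D" "1 \<le> lookup m v" unfolding order_above_1 by blast
    have "Poly_Mapping.single v 1 \<preceq> m" using v(2) by (simp add: mdvd_def lookup_single when_def)
    moreover have "Poly_Mapping.single (Poly_Mapping.single v 1) 1 \<in> P"
      using C(1) D v(1) by (auto simp: var_def)
    ultimately show "\<exists>s. s \<preceq> m \<and> Poly_Mapping.single s 1 \<in> P" by blast
  qed
  have varmem: "var v \<in> (cover_prime D :: ('v, 'k) mpoly set) \<longleftrightarrow> v \<in> D" for v D
    unfolding cover_prime_def monomial_ideal_def var_def mem_Collect_eq keys_single
    by (simp add: order_above_1[unfolded One_nat_def] lookup_single when_def)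
  have mono: "(cover_prime D :: ('v, 'k) mpoly set) \<subseteq> cover_prime D'" if "D \<subseteq> D'" for D D'
  proof -
    have "order_above D 1 \<subseteq> order_above D' 1"
      unfolding subset_iff order_above_1 using that by blast
    then show ?thesis unfolding cover_prime_def monomial_ideal_def by blast
  qed
  obtain h where h: "bij_betw h {..<n} C"
    using card[OF C(2)] ex_bij_betw_nat_finite[of C] by (metis finite lessThan_atLeast0)
  \<comment> \<open>the last prime of the chain is \<open>P\<close> itself, which may be larger than the cover prime\<close>
  define c where "c i = (if i < n then cover_prime (h ` {..<i}) else P)" for i
  have hC: "h ` {..<i} \<subseteq> C" if "i \<le> n" for i
    using bij_betw_imp_surj_on[OF h] that by auto
  have "primeideal (c i) ?R" for i
    using P by (simp add: c_def cover_prime_prime)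
  moreover have "c i \<subset> c (Suc i)" if i: "i < n" for i
  proof -
    have hi: "h i \<notin> h ` {..<i}"
    proof
      assume "h i \<in> h ` {..<i}"
      then obtain j where "j < i" "h i = h j" by auto
      then show False using inj_onD[OF bij_betw_imp_inj_on[OF h], of i j] i by simp
    qed
    then have no: "var (h i) \<notin> c i" using i by (simp add: c_def varmem)
    have "c i \<subseteq> c (Suc i) \<and> var (h i) \<in> c (Suc i)"
    proof (cases "Suc i < n")
      case True
      have "h ` {..<i} \<subseteq> h ` {..<Suc i}" by auto
      then show ?thesis using True i mono by (simp add: c_def varmem)
    next
      case False
      have "h i \<in> C" using bij_betwE[OF h] i by blast
      then have "var (h i) \<in> P" using C(1) by blast
      then show ?thesis using False i subP[OF hC[of i]] by (simp add: c_def)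
    qed
    with no show ?thesis by blast
  qed
  moreover have "c n = P" by (simp add: c_def)
  ultimately have "enat n \<in> {enat t | t c. c t = P \<and> (\<forall>i\<le>t. primeideal (c i) ?R) \<and> (\<forall>i<t. c i \<subset> c (Suc i))}"
    by blast
  then show "enat n \<le> prime_height ?R P"
    unfolding prime_height_def by (rule Sup_upper)
qed

section \<open>Symbolic powers\<close>

text \<open>
  The sets in \<open>\<C>\<close> are the covers that generate associated primes, and powers of such primes are monomial
  ideals.
\<close>

lemma symbolic_power_monomial:
  fixes E :: "'v::finite set set"
  assumes simple: "simple_graph E"
  shows "\<exists>\<C>. (\<forall>C\<in>\<C>. minimal_vertex_cover E C) \<and>
    (\<forall>k. symbolic_power ring_of_type_algebra (edge_ideal E :: ('v, 'k::field) mpoly set) k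
       = monomial_ideal {m. \<forall>C\<in>\<C>. m \<in> order_above C k})"
proof -
  let ?A = "associated_primes ring_of_type_algebra (edge_ideal E :: ('v, 'k) mpoly set)"
  define \<C> where "\<C> = {C. minimal_vertex_cover E C \<and> cover_prime C \<in> ?A}"
  have A: "?A = cover_prime ` \<C>"
  proof (intro equalityI subsetI)
    fix P assume P: "P \<in> ?A"
    obtain C where "minimal_vertex_cover E C" "P = cover_prime C"
      using associated_prime_is_cover_prime[OF simple P] by blast
    with P show "P \<in> cover_prime ` \<C>" by (simp add: \<C>_def)
  next
    fix P :: "('v, 'k) mpoly set" assume "P \<in> cover_prime ` \<C>"
    then show "P \<in> ?A" by (auto simp: \<C>_def)
  qed
  have "symbolic_power ring_of_type_algebra (edge_ideal E :: ('v, 'k) mpoly set) k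
      = monomial_ideal {m. \<forall>C\<in>\<C>. m \<in> order_above C k}" for k
  proof -
    have "symbolic_power ring_of_type_algebra (edge_ideal E :: ('v, 'k) mpoly set) k
        = (\<Inter>C\<in>\<C>. monomial_ideal (order_above C k))"
      unfolding symbolic_power_def A by (simp add: cover_prime_power)
    also have "\<dots> = monomial_ideal {m. \<forall>C\<in>\<C>. m \<in> order_above C k}"
      unfolding monomial_ideal_def by blast
    finally show ?thesis .
  qed
  moreover have "\<forall>C\<in>\<C>. minimal_vertex_cover E C" by (simp add: \<C>_def)
  ultimately show ?thesis by (intro exI[of _ \<C>] conjI allI)
qed

lemma very_well_covered_edge:
  fixes E :: "'v::finite set set"
  assumes simple: "simple_graph E" and vwc: "very_well_covered TYPE('k::field) E"
  shows "\<exists>x y. x \<noteq> y \<and> {x, y} \<in> E \<and> (\<forall>D. minimal_vertex_cover E D \<longrightarrow> card (D \<inter> {x, y}) = 1)"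
proof (rule edge_met_once[OF simple])
  show un: "unmixed E" and "\<forall>v. \<exists>e\<in>E. v \<in> e"
    using vwc by (simp_all add: very_well_covered_def)
  fix C assume C: "minimal_vertex_cover E C"
  have "card D = card C" if "minimal_vertex_cover E D" for D
    using un C that unfolding unmixed_def by blast
  then have "enat (card C) \<le> ideal_height ring_of_type_algebra (edge_ideal E :: ('v, 'k) mpoly set)"
    by (rule height_ge_cover[OF simple])
  then have "2 * enat (card C) \<le> 2 * ideal_height ring_of_type_algebra (edge_ideal E :: ('v, 'k) mpoly set)"
    by (rule mult_left_mono) simp
  also have "\<dots> = enat (card (UNIV :: 'v set))"
    using vwc by (simp add: very_well_covered_def)
  finally show "2 * card C \<le> card (UNIV :: 'v set)"
    by (simp add: numeral_eq_enat)
qed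

theorem proposition5p6:
  fixes E :: "'v::finite set set"
    and I :: "('v, 'k::field) mpoly set"
  assumes "simple_graph E"
    and "very_well_covered TYPE('k) E"
    and "I = edge_ideal E"
  shows "\<forall>k\<ge>1. regularity_quotient (symbolic_power ring_of_type_algebra I k)
              \<le> regularity_quotient (symbolic_power ring_of_type_algebra I (k + 1))"
proof (intro allI impI)
  fix k :: nat assume k: "1 \<le> k"
  obtain x y where xy: "x \<noteq> y" "\<forall>D. minimal_vertex_cover E D \<longrightarrow> card (D \<inter> {x, y}) = 1"
    using very_well_covered_edge[OF assms(1,2)] by blast
  obtain \<C> where min: "\<forall>C\<in>\<C>. minimal_vertex_cover E C"
    and sym: "\<forall>k. symbolic_power ring_of_type_algebra I k
      = monomial_ideal {m. \<forall>C\<in>\<C>. m \<in> order_above C k}"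
    using symbolic_power_monomial[OF assms(1)] unfolding assms(3) by blast
  define S where "S j = {m :: 'v \<Rightarrow>\<^sub>0 nat. \<forall>C\<in>\<C>. m \<in> order_above C j}" for j
  define t :: "'v \<Rightarrow>\<^sub>0 nat" where "t = Poly_Mapping.single x 1 + Poly_Mapping.single y 1"
  have deg_t: "(\<Sum>v\<in>C. lookup t v) = 1" if "C \<in> \<C>" for C
  proof -
    have "lookup t v = (if v \<in> {x, y} then 1 else 0)" for v
      using xy(1) by (auto simp: t_def lookup_add lookup_single when_def)
    then have "(\<Sum>v\<in>C. lookup t v) = (\<Sum>v\<in>C. if v \<in> {x, y} then 1 else 0)" by (simp only:)
    also have "\<dots> = card (C \<inter> {x, y})"
      by (simp only: sum.inter_restrict[symmetric] finite card_eq_sum)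
    also have "\<dots> = 1" using xy(2) min that by blast
    finally show ?thesis .
  qed
  have colon: "{m. m + t \<in> S (k + 1)} = S k"
    using deg_t by (simp add: S_def order_above_def lookup_add sum.distrib)
  have up: "up_closed (S (k + 1))"
    unfolding up_closed_def
  proof (intro allI impI)
    fix a b assume ab: "a \<in> S (k + 1)" "a \<preceq> b"
    have "b \<in> order_above C (k + 1)" if "C \<in> \<C>" for C
    proof -
      have "a \<in> order_above C (k + 1)" using ab(1) that by (simp add: S_def)
      with ab(2) show ?thesis
        using order_above_up_closed[of C "k + 1"] unfolding up_closed_def by blast
    qed
    then show "b \<in> S (k + 1)" by (simp add: S_def)
  qed
  have "regularity_quotient (monomial_ideal (S k) :: ('v, 'k) mpoly set)
      \<le> regularity_quotient (monomial_ideal (S (k + 1)) :: ('v, 'k) mpoly set)"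
  \<comment> \<open>the colon ideal is the whole ring only if there are no associated primes\<close>
  proof (cases "t \<in> S (k + 1)")
    case True
    then have "0 \<in> {m. m + t \<in> S (k + 1)}" by simp
    then have 0: "0 \<in> S k" unfolding colon .
    have "C \<notin> \<C>" for C
    proof
      assume "C \<in> \<C>"
      with 0 have "0 \<in> order_above C k" by (simp add: S_def)
      then show False using k by (simp add: order_above_def)
    qed
    then have "\<C> = {}" by blast
    then have "\<C> = {}" by blast
    then have "S (k + 1) = S k" by (simp add: S_def)
    then show ?thesis by simp
  next
    case False
    from regularity_colon_monomial[OF up False, where ?'k = 'k] show ?thesis
      unfolding colon .
  qed
  then show "regularity_quotient (symbolic_power ring_of_type_algebra I k)
      \<le> regularity_quotient (symbolic_power ring_of_type_algebra I (k + 1))"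
    using sym by (simp add: S_def)
qed

end
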